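(* For each integer $n\ge 1$ let $H(z)=p_n(z)+\overline{q_n(z)}$ be a random harmonic polynomial from the harmonic Kac ensemble with $m=n$. Then $$\mathbb{E}\, N_H(\mathbb{C}) \sim \tfrac12\, n\log n \qquad (n\to\infty).$$
   Context: Harmonic Kac ensemble: for integers $n\ge m\ge 1$, $H(z)=p_n(z)+\overline{q_m(z)}$ with $p_n(z)=\sum_{k=0}^n A_k z^k$ and $q_m(z)=\sum_{k=0}^m B_k z^k$, where $A_0,\dots,A_n,B_0,\dots,B_m$ are i.i.d. standard complex Gaussians, i.e. each equals $X+iY$ with $X,Y$ independent real $N(0,1/2)$ variables. For a set $T\subseteq\mathbb{C}$, $N_H(T)$ denotes the number of zeros of $H$ (points $z\in T$ with $H(z)=0$) in $T$. $\log$ is the natural logarithm. *)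

theory Defs
  imports "HOL-Probability.Probability" "HOL-Library.Landau_Symbols"
begin

definition real_gauss_half :: "real measure" where
  "real_gauss_half = density lborel (normal_density 0 (sqrt (1/2)))"

definition cgauss :: "complex measure" where
  "cgauss = distr (real_gauss_half \<Otimes>\<^sub>M real_gauss_half) borel (\<lambda>(x, y). Complex x y)"

definition harm_kac :: "nat \<Rightarrow> nat \<Rightarrow> ((nat \<Rightarrow> complex) \<times> (nat \<Rightarrow> complex)) measure" where
  "harm_kac n m = (\<Pi>\<^sub>M k\<in>{..n}. cgauss) \<Otimes>\<^sub>M (\<Pi>\<^sub>M k\<in>{..m}. cgauss)"

definition harm_poly :: "nat \<Rightarrow> nat \<Rightarrow> (nat \<Rightarrow> complex) \<times> (nat \<Rightarrow> complex) \<Rightarrow> complex \<Rightarrow> complex" where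
  "harm_poly n m AB z = (\<Sum>k\<le>n. fst AB k * z ^ k) + cnj (\<Sum>k\<le>m. snd AB k * z ^ k)"

definition num_zeros :: "(complex \<Rightarrow> complex) \<Rightarrow> complex set \<Rightarrow> ennreal" where
  "num_zeros H T = (if finite {z\<in>T. H z = 0} then ennreal (real (card {z\<in>T. H z = 0})) else \<infinity>)"

definition expected_zeros :: "nat \<Rightarrow> nat \<Rightarrow> complex set \<Rightarrow> ennreal" where
  "expected_zeros n m T = (\<integral>\<^sup>+ AB. num_zeros (harm_poly n m AB) T \<partial>harm_kac n m)"

end

theory Submission
  imports Defs "HOL-Real_Asymp.Real_Asymp"
begin

text \<open>
  Condition on all coefficients except \<open>A\<^sub>0\<close>. The zeros of \<open>H\<close> are then the preimages of the
  independent Gaussian \<open>A\<^sub>0\<close> under a fixed harmonic map \<open>G\<close>, so the area formula turns the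
  expected number of zeros into the integral over \<open>z\<close> of the expectation of \<open>|det DG(z)|\<close> times the
  Gaussian density at \<open>G(z)\<close>. For fixed \<open>z\<close> this involves only a few linear functionals of the
  coefficients, whose joint law depends only on their covariances because Gaussian measures are
  invariant under rotations. When \<open>m = n\<close> the conditional law of the Jacobian is that of a multiple
  of \<open>|X|\<^sup>2 - |Y|\<^sup>2\<close> with \<open>X, Y\<close> independent standard Gaussians, and \<open>E||X|\<^sup>2 - |Y|\<^sup>2| = 1\<close>.
  With \<open>S\<close> and \<open>V\<close> the second moment and the variance of \<open>k\<close> under the weights \<open>t\<^sup>k\<close>,
  \<open>0 \<le> k \<le> n\<close>, the expected number of zeros is the integral of \<open>sqrt (S V) / (2 t)\<close> over \<open>t > 0\<close>.
  The region \<open>t < 1\<close> contributes \<open>O(n)\<close>; for \<open>t > 1\<close> one has \<open>S \<approx> n\<^sup>2\<close> and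
  \<open>V \<approx> t / (t - 1)\<^sup>2\<close> down to \<open>t - 1 \<approx> 1 / n\<close>, which produces \<open>(n / 2) ln n\<close>.
\<close>

section \<open>Rotation invariance of the complex Gaussian\<close>

text \<open>No regular conditional law is constructed: integrating over \<open>A_0\<close> first
  turns the event \<open>H(z) = 0\<close> into a Gaussian weight at the remaining part of
  \<open>H(z)\<close>. The price is an asymmetry. With \<open>a\<close>, \<open>b\<close>,
  \<open>d\<close> the sums over \<open>k\<close> of \<open>t^k\<close>, \<open>k t^k\<close>,
  \<open>k^2 t^k\<close>, the value of \<open>p\<close> without its constant term has variance
  \<open>a - 1\<close>, that of \<open>q\<close> has variance \<open>a\<close>. The weight restores
  the balance: it acts as conditioning a variable of variance \<open>2a\<close>, which gives the
  density factor \<open>1 / (2 pi a)\<close> and leaves \<open>z p'\<close>, \<open>z q'\<close>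
  with equal variances \<open>d - b^2/(2a)\<close> and covariance \<open>-b^2/(2a)\<close>. This
  equality is where \<open>m = n\<close> enters. The eigenvalues are \<open>d\<close> and
  \<open>d - b^2/a\<close>, and the Jacobian scales by their geometric mean, whence
  \<open>S = d/a\<close> and \<open>V = (d - b^2/a)/a\<close>. All covariances can be taken real
  because the phases of \<open>z^k\<close> are absorbed into the coefficients, so rotations of two
  variables at a time suffice.\<close>

lemma nn_integral_lborel_affine:
  fixes f :: "'a::euclidean_space \<Rightarrow> ennreal"
  assumes [measurable]: "f \<in> borel_measurable borel" and c: "c \<noteq> 0"
  shows "(\<integral>\<^sup>+x. f x \<partial>lborel) = ennreal (\<bar>c\<bar> ^ DIM('a)) * (\<integral>\<^sup>+x. f (t + c *\<^sub>R x) \<partial>lborel)"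
  by (subst lborel_affine[OF c, of t])
     (simp add: nn_integral_density nn_integral_distr nn_integral_cmult)

lemma nn_integral_lborel_rotation:
  fixes g :: "'a::euclidean_space \<times> 'a \<Rightarrow> ennreal" and c s :: real
  assumes [measurable]: "g \<in> borel_measurable (borel \<Otimes>\<^sub>M borel)" and cs: "c\<^sup>2 + s\<^sup>2 = 1"
  shows "(\<integral>\<^sup>+x. \<integral>\<^sup>+y. g (c *\<^sub>R x - s *\<^sub>R y, s *\<^sub>R x + c *\<^sub>R y) \<partial>lborel \<partial>lborel) =
         (\<integral>\<^sup>+x. \<integral>\<^sup>+y. g (x, y) \<partial>lborel \<partial>lborel)"
proof (cases "s = 0")
  case True
  then have c: "c \<noteq> 0" "\<bar>c\<bar> = 1"
    using cs by (auto simp: power2_eq_1_iff)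
  have "(\<integral>\<^sup>+x. \<integral>\<^sup>+y. g (x, y) \<partial>lborel \<partial>lborel) = (\<integral>\<^sup>+x. \<integral>\<^sup>+y. g (x, c *\<^sub>R y) \<partial>lborel \<partial>lborel)"
    by (rule nn_integral_cong, subst nn_integral_lborel_affine[OF _ c(1), where t = 0]) (simp_all add: c)
  also have "\<dots> = (\<integral>\<^sup>+x. \<integral>\<^sup>+y. g (c *\<^sub>R x, c *\<^sub>R y) \<partial>lborel \<partial>lborel)"
    by (subst nn_integral_lborel_affine[OF _ c(1), where t = 0]) (simp_all add: c)
  finally show ?thesis using True by simp
next
  case False
  let ?D = "DIM('a)"
  have "(\<integral>\<^sup>+y. g (c *\<^sub>R x - s *\<^sub>R y, s *\<^sub>R x + c *\<^sub>R y) \<partial>lborel) =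
      ennreal (\<bar>1/s\<bar> ^ ?D) * (\<integral>\<^sup>+u. g (u, (1/s) *\<^sub>R x - (c/s) *\<^sub>R u) \<partial>lborel)" for x :: 'a
  proof (subst nn_integral_lborel_affine[where c = "-1/s" and t = "(c/s) *\<^sub>R x"])
    have "s *\<^sub>R x + c *\<^sub>R ((c/s) *\<^sub>R x + (- 1/s) *\<^sub>R u) = (1/s) *\<^sub>R x - (c/s) *\<^sub>R u" for u :: 'a
    proof -
      have "s *\<^sub>R x + c *\<^sub>R ((c/s) *\<^sub>R x + (- 1/s) *\<^sub>R u) = (s + c * (c / s)) *\<^sub>R x - (c/s) *\<^sub>R u"
        by (simp add: algebra_simps)
      also have "s + c * (c / s) = 1 / s"
        using False cs by (simp add: field_simps power2_eq_square)
      finally show ?thesis .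
    qed
    moreover have "c *\<^sub>R x - s *\<^sub>R ((c/s) *\<^sub>R x + (- 1/s) *\<^sub>R u) = u" for u :: 'a
      using False by (simp add: algebra_simps)
    ultimately show "ennreal (\<bar>- 1 / s\<bar> ^ ?D) *
        (\<integral>\<^sup>+u. g (c *\<^sub>R x - s *\<^sub>R ((c/s) *\<^sub>R x + (- 1/s) *\<^sub>R u),
           s *\<^sub>R x + c *\<^sub>R ((c/s) *\<^sub>R x + (- 1/s) *\<^sub>R u)) \<partial>lborel) =
        ennreal (\<bar>1/s\<bar> ^ ?D) * (\<integral>\<^sup>+u. g (u, (1/s) *\<^sub>R x - (c/s) *\<^sub>R u) \<partial>lborel)"
      by simp
  qed (use False in auto)
  then have "(\<integral>\<^sup>+x. \<integral>\<^sup>+y. g (c *\<^sub>R x - s *\<^sub>R y, s *\<^sub>R x + c *\<^sub>R y) \<partial>lborel \<partial>lborel) =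
      ennreal (\<bar>1/s\<bar> ^ ?D) * (\<integral>\<^sup>+x. \<integral>\<^sup>+u. g (u, (1/s) *\<^sub>R x - (c/s) *\<^sub>R u) \<partial>lborel \<partial>lborel)"
    by (simp add: nn_integral_cmult)
  also have "(\<integral>\<^sup>+x. \<integral>\<^sup>+u. g (u, (1/s) *\<^sub>R x - (c/s) *\<^sub>R u) \<partial>lborel \<partial>lborel) =
      (\<integral>\<^sup>+u. \<integral>\<^sup>+x. g (u, (1/s) *\<^sub>R x - (c/s) *\<^sub>R u) \<partial>lborel \<partial>lborel)"
    by (rule lborel_pair.Fubini') measurable
  also have "\<dots> = (\<integral>\<^sup>+u. ennreal (\<bar>s\<bar> ^ ?D) * (\<integral>\<^sup>+x. g (u, x) \<partial>lborel) \<partial>lborel)"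
  proof (rule nn_integral_cong)
    fix u :: 'a
    have "(1/s) *\<^sub>R (c *\<^sub>R u + s *\<^sub>R x) - (c/s) *\<^sub>R u = x" for x
      using False by (simp add: algebra_simps)
    then show "(\<integral>\<^sup>+x. g (u, (1/s) *\<^sub>R x - (c/s) *\<^sub>R u) \<partial>lborel) =
        ennreal (\<bar>s\<bar> ^ ?D) * (\<integral>\<^sup>+x. g (u, x) \<partial>lborel)"
      by (subst nn_integral_lborel_affine[OF _ False, where t = "c *\<^sub>R u"]) simp_all
  qed
  also have "\<dots> = ennreal (\<bar>s\<bar> ^ ?D) * (\<integral>\<^sup>+u. \<integral>\<^sup>+x. g (u, x) \<partial>lborel \<partial>lborel)"
    by (simp add: nn_integral_cmult)
  also have "ennreal (\<bar>1/s\<bar> ^ ?D) * (ennreal (\<bar>s\<bar> ^ ?D) * (\<integral>\<^sup>+u. \<integral>\<^sup>+x. g (u, x) \<partial>lborel \<partial>lborel)) =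
      (\<integral>\<^sup>+u. \<integral>\<^sup>+x. g (u, x) \<partial>lborel \<partial>lborel)"
    using False by (simp add: mult.assoc[symmetric] ennreal_mult[symmetric] power_mult_distrib[symmetric])
  finally show ?thesis .
qed

section \<open>The complex Gaussian as a planar density\<close>

lemma measurable_Complex [measurable]:
  "case_prod Complex \<in> borel_measurable (borel \<Otimes>\<^sub>M borel)"
  by (simp add: Complex_eq split_beta')

lemma lborel_complex_eq: "(lborel :: complex measure) = distr (lborel \<Otimes>\<^sub>M lborel) borel (\<lambda>(x, y). Complex x y)"
proof (rule lborel_eqI)
  fix l u :: complex
  assume lu: "\<And>b. b \<in> Basis \<Longrightarrow> l \<bullet> b \<le> u \<bullet> b"
  then have le: "Re l \<le> Re u" "Im l \<le> Im u"
    using lu[of 1] lu[of \<i>] by (auto simp: Basis_complex_def inner_complex_def)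
  have "emeasure (distr (lborel \<Otimes>\<^sub>M lborel) borel (\<lambda>(x, y). Complex x y)) (box l u) =
      emeasure (lborel \<Otimes>\<^sub>M lborel) ((\<lambda>(x, y). Complex x y) -` box l u \<inter> space (lborel \<Otimes>\<^sub>M lborel))"
    by (rule emeasure_distr) auto
  also have "(\<lambda>(x, y). Complex x y) -` box l u \<inter> space (lborel \<Otimes>\<^sub>M lborel) = {Re l<..<Re u} \<times> {Im l<..<Im u}"
    by (auto simp: box_def Basis_complex_def inner_complex_def space_pair_measure)
  also have "emeasure (lborel \<Otimes>\<^sub>M lborel) \<dots> = ennreal (Re u - Re l) * ennreal (Im u - Im l)"
    using le by (subst lborel.emeasure_pair_measure_Times) auto
  also have "\<dots> = ennreal (\<Prod>b\<in>Basis. (u - l) \<bullet> b)"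
    using le by (simp add: Basis_complex_def inner_complex_def ennreal_mult')
  finally show "emeasure (distr (lborel \<Otimes>\<^sub>M lborel) borel (\<lambda>(x, y). Complex x y)) (box l u) =
      ennreal (\<Prod>b\<in>Basis. (u - l) \<bullet> b)" by simp
qed simp

lemma nn_integral_lborel_complex:
  assumes [measurable]: "f \<in> borel_measurable borel"
  shows "(\<integral>\<^sup>+z. f z \<partial>lborel) = (\<integral>\<^sup>+x. \<integral>\<^sup>+y. f (Complex x y) \<partial>lborel \<partial>lborel)"
proof -
  have [measurable]: "(\<lambda>(x, y). f (Complex x y)) \<in> borel_measurable (borel \<Otimes>\<^sub>M borel)"
    using measurable_compose[OF measurable_Complex assms] by (simp add: split_beta')
  show ?thesis
    by (subst lborel_complex_eq, subst nn_integral_distr)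
       (simp_all add: lborel.nn_integral_fst[symmetric] split_beta')
qed

text \<open>Variance 1/2 in each real coordinate makes the exponent exactly minus the squared
  modulus and the normalising constant pi.\<close>

definition gauss_density :: "complex \<Rightarrow> real" where
  "gauss_density z = exp (- (norm z)\<^sup>2) / pi"

lemma gauss_density_nonneg [simp]: "0 \<le> gauss_density z"
  and gauss_density_measurable [measurable]: "gauss_density \<in> borel_measurable borel"
  unfolding gauss_density_def by simp_all

lemma cgauss_eq_density: "cgauss = density lborel (\<lambda>z. ennreal (gauss_density z))"
proof -
  let ?\<phi> = "\<lambda>x. ennreal (normal_density 0 (sqrt (1/2)) x)"
  interpret G: prob_space "density lborel ?\<phi>"
    by (rule prob_space_normal_density) auto
  have "real_gauss_half \<Otimes>\<^sub>M real_gauss_half = density (lborel \<Otimes>\<^sub>M lborel) (\<lambda>(x, y). ?\<phi> x * ?\<phi> y)"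
    unfolding real_gauss_half_def
    by (rule pair_measure_density) (auto intro: sigma_finite_lborel G.sigma_finite_measure)
  also have "(\<lambda>(x, y). ?\<phi> x * ?\<phi> y) = (\<lambda>(x, y). ennreal (gauss_density (Complex x y)))"
    by (auto simp: fun_eq_iff gauss_density_def normal_density_def ennreal_mult[symmetric] exp_add[symmetric]
          cmod_def power2_eq_square real_sqrt_mult[symmetric] algebra_simps
          simp del: real_sqrt_mult)
  finally have *: "real_gauss_half \<Otimes>\<^sub>M real_gauss_half =
    density (lborel \<Otimes>\<^sub>M lborel) (\<lambda>(x, y). ennreal (gauss_density (Complex x y)))" .
  show ?thesis
    unfolding cgauss_def *
    by (subst lborel_complex_eq, subst density_distr) (auto simp: split_beta')
qed

lemma sets_cgauss [measurable_cong, simp]: "sets cgauss = sets borel"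
  and space_cgauss [simp]: "space cgauss = UNIV"
  by (simp_all add: cgauss_def)

lemma prob_space_cgauss: "prob_space cgauss"
proof -
  interpret G: prob_space real_gauss_half
    unfolding real_gauss_half_def by (rule prob_space_normal_density) auto
  interpret GG: pair_prob_space real_gauss_half real_gauss_half ..
  have [measurable_cong]: "sets real_gauss_half = sets borel"
    by (simp add: real_gauss_half_def)
  show ?thesis
    unfolding cgauss_def by (rule GG.prob_space_distr) auto
qed

interpretation cgauss: prob_space cgauss
  by (rule prob_space_cgauss)

lemma emeasure_cgauss_UNIV [simp]: "emeasure cgauss UNIV = 1"
  using cgauss.emeasure_space_1 by simp

interpretation cgauss_pair: pair_sigma_finite cgauss cgauss ..

lemma nn_integral_cgauss:
  "f \<in> borel_measurable borel \<Longrightarrow>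
    (\<integral>\<^sup>+z. f z \<partial>cgauss) = (\<integral>\<^sup>+z. ennreal (gauss_density z) * f z \<partial>lborel)"
  unfolding cgauss_eq_density by (rule nn_integral_density) auto

lemma nn_integral_cgauss2:
  assumes [measurable]: "f \<in> borel_measurable (borel \<Otimes>\<^sub>M borel)"
  shows "(\<integral>\<^sup>+x. \<integral>\<^sup>+y. f (x, y) \<partial>cgauss \<partial>cgauss) =
    (\<integral>\<^sup>+x. \<integral>\<^sup>+y. ennreal (gauss_density x * gauss_density y) * f (x, y) \<partial>lborel \<partial>lborel)"
  by (simp add: nn_integral_cgauss nn_integral_cmult[symmetric] ennreal_mult mult.assoc)

text \<open>The product density depends only on the sum of the two squared moduli, which a real
  rotation preserves.\<close>

lemma nn_integral_cgauss_rotation: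
  fixes c s :: real
  assumes [measurable]: "g \<in> borel_measurable (borel \<Otimes>\<^sub>M borel)" and cs: "c\<^sup>2 + s\<^sup>2 = 1"
  shows "(\<integral>\<^sup>+x. \<integral>\<^sup>+y. g (c * x - s * y, s * x + c * y) \<partial>cgauss \<partial>cgauss) =
         (\<integral>\<^sup>+x. \<integral>\<^sup>+y. g (x, y) \<partial>cgauss \<partial>cgauss)"
proof -
  have eq: "gauss_density (c *\<^sub>R x - s *\<^sub>R y) * gauss_density (s *\<^sub>R x + c *\<^sub>R y) =
      gauss_density x * gauss_density y" for x y
  proof -
    have "(norm (c *\<^sub>R x - s *\<^sub>R y))\<^sup>2 + (norm (s *\<^sub>R x + c *\<^sub>R y))\<^sup>2 = (c\<^sup>2 + s\<^sup>2) * ((norm x)\<^sup>2 + (norm y)\<^sup>2)"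
      unfolding cmod_power2 by (simp add: power2_eq_square algebra_simps)
    then show ?thesis
      using cs by (simp add: gauss_density_def exp_add[symmetric])
  qed
  show ?thesis
    using nn_integral_lborel_rotation[of "\<lambda>(x, y). ennreal (gauss_density x * gauss_density y) * g (x, y)" c s] cs
      nn_integral_cgauss2[of g] nn_integral_cgauss2[of "\<lambda>(x, y). g (c * x - s * y, s * x + c * y)"]
    by (simp add: eq[unfolded scaleR_conv_of_real] scaleR_conv_of_real)
qed

text \<open>Multiplication by a unit is a rotation of the real and imaginary parts. This is what
  allows the phase of \<open>z^k\<close> to be dropped from the coefficient of index
  \<open>k\<close>.\<close>

lemma nn_integral_cgauss_unit:
  assumes [measurable]: "f \<in> borel_measurable borel" and u: "norm u = 1"
  shows "(\<integral>\<^sup>+x. f (u * x) \<partial>cgauss) = (\<integral>\<^sup>+x. f x \<partial>cgauss)"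
proof -
  have u2: "(Re u)\<^sup>2 + (Im u)\<^sup>2 = 1"
    using u by (simp add: cmod_power2[symmetric])
  have [measurable]: "(\<lambda>p. h (Complex (fst p) (snd p))) \<in> borel_measurable (borel \<Otimes>\<^sub>M borel)"
    if [measurable]: "h \<in> borel_measurable borel" for h :: "complex \<Rightarrow> ennreal"
    using measurable_compose[OF measurable_Complex that] by (simp add: split_beta')
  have *: "u * Complex x y = Complex (Re u * x - Im u * y) (Im u * x + Re u * y)"
      "gauss_density (Complex (Re u * x - Im u * y) (Im u * x + Re u * y)) = gauss_density (Complex x y)" for x y
  proof -
    show eq: "u * Complex x y = Complex (Re u * x - Im u * y) (Im u * x + Re u * y)"
      by (simp add: complex_eq_iff)
    show "gauss_density (Complex (Re u * x - Im u * y) (Im u * x + Re u * y)) = gauss_density (Complex x y)"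
      unfolding eq[symmetric] using u by (simp add: gauss_density_def norm_mult)
  qed
  show ?thesis
    using nn_integral_lborel_rotation[of "\<lambda>p. ennreal (gauss_density (Complex (fst p) (snd p))) * f (Complex (fst p) (snd p))", OF _ u2]
    by (simp add: nn_integral_cgauss nn_integral_lborel_complex *)
qed

lemma cnj_measurable [measurable]: "cnj \<in> borel_measurable borel"
  by (intro borel_measurable_continuous_onI continuous_intros)

lemma nn_integral_cgauss_cnj:
  assumes [measurable]: "f \<in> borel_measurable borel"
  shows "(\<integral>\<^sup>+x. f (cnj x) \<partial>cgauss) = (\<integral>\<^sup>+x. f x \<partial>cgauss)"
proof -
  have [measurable]: "Complex x \<in> borel_measurable borel" for x
    by (simp add: Complex_eq[abs_def])
  have *: "cnj (Complex x y) = Complex x (-y)" "gauss_density (Complex x (-y)) = gauss_density (Complex x y)" for x y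
    by (simp_all add: complex_eq_iff gauss_density_def cmod_def)
  have eq: "(\<integral>\<^sup>+y. ennreal (gauss_density (Complex x y)) * f (cnj (Complex x y)) \<partial>lborel) =
      (\<integral>\<^sup>+y. ennreal (gauss_density (Complex x y)) * f (Complex x y) \<partial>lborel)" for x
    by (subst (2) nn_integral_real_affine[where t = 0 and c = "-1"]) (simp_all add: *)
  show ?thesis
    by (simp add: nn_integral_cgauss nn_integral_lborel_complex eq)
qed

section \<open>Linear functionals of Gaussian families\<close>

text \<open>Rotate so that the given combination becomes \<open>d\<close> times the first
  coordinate; the second coordinate then integrates to 1.\<close>

lemma nn_integral_cgauss_combine:
  fixes a b :: real
  assumes [measurable]: "f \<in> borel_measurable borel"
  shows "(\<integral>\<^sup>+x. \<integral>\<^sup>+y. f (a * x + b * y) \<partial>cgauss \<partial>cgauss) = (\<integral>\<^sup>+x. f (sqrt (a\<^sup>2 + b\<^sup>2) * x) \<partial>cgauss)"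
proof (cases "a\<^sup>2 + b\<^sup>2 = 0")
  case True
  then show ?thesis by (simp add: sum_power2_eq_zero_iff)
next
  case False
  define d where "d = sqrt (a\<^sup>2 + b\<^sup>2)"
  have d: "d \<noteq> 0" "d\<^sup>2 = a\<^sup>2 + b\<^sup>2"
    using False by (simp_all add: d_def)
  have "(a / d)\<^sup>2 + (- b / d)\<^sup>2 = 1"
    using d by (simp add: power_divide add_divide_distrib[symmetric] d(2)[symmetric] del: sum_power2_eq_zero_iff)
  from nn_integral_cgauss_rotation[OF _ this, of "\<lambda>p. f (d * fst p)"]
  show ?thesis
    using d(1) by (simp add: d_def[symmetric] algebra_simps)
qed

text \<open>The expectation of \<open>f (u, v)\<close> for a centred circular Gaussian pair with \<open>E|u|\<^sup>2 = p\<close>,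
  \<open>E|v|\<^sup>2 = r\<close> and real covariance \<open>q\<close>. For \<open>p = 0\<close> the junk values of division give the
  correct coefficients.\<close>

definition bigauss :: "real \<Rightarrow> real \<Rightarrow> real \<Rightarrow> (complex \<times> complex \<Rightarrow> ennreal) \<Rightarrow> ennreal" where
  "bigauss p q r f = (\<integral>\<^sup>+x. \<integral>\<^sup>+y. f (sqrt p * x, (q / sqrt p) * x + sqrt (r - q\<^sup>2 / p) * y) \<partial>cgauss \<partial>cgauss)"

lemma bigauss_coeffs:
  assumes "0 \<le> p" "0 \<le> r" "q\<^sup>2 \<le> p * r"
  shows "(sqrt p)\<^sup>2 = p" "sqrt p * (q / sqrt p) = q" "(q / sqrt p)\<^sup>2 + (sqrt (r - q\<^sup>2 / p))\<^sup>2 = r"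
proof -
  show "(sqrt p)\<^sup>2 = p" using assms by simp
  show "sqrt p * (q / sqrt p) = q"
    using assms by (cases "p = 0") auto
  have "q\<^sup>2 / p \<le> r"
    using assms by (cases "p = 0") (auto simp: divide_simps mult.commute)
  then show "(q / sqrt p)\<^sup>2 + (sqrt (r - q\<^sup>2 / p))\<^sup>2 = r"
    using assms by (simp add: power_divide)
qed

text \<open>Covariances of independent summands add. Only two rotations are involved: one
  concentrates the first component on a single variable, the other merges what is left in the second
  component. Iterating this replaces any theory of Gaussian vectors.\<close>

lemma bigauss_step:
  assumes f[measurable]: "f \<in> borel_measurable (borel \<Otimes>\<^sub>M borel)"
    and pqr: "0 \<le> p" "0 \<le> r" "q\<^sup>2 \<le> p * r"
  shows "(\<integral>\<^sup>+z. bigauss p q r (\<lambda>(u, v). f (u + complex_of_real a * z, v + complex_of_real b * z)) \<partial>cgauss) =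
    bigauss (p + a\<^sup>2) (q + a * b) (r + b\<^sup>2) f"
proof -
  define \<alpha> \<beta> \<gamma> where "\<alpha> = sqrt p" and "\<beta> = q / sqrt p" and "\<gamma> = sqrt (r - q\<^sup>2 / p)"
  note coeffs = bigauss_coeffs[OF pqr, folded \<alpha>_def \<beta>_def \<gamma>_def]
  define P Q R where "P = p + a\<^sup>2" and "Q = q + a * b" and "R = r + b\<^sup>2"
  define g where "g = (\<lambda>(x::complex, z::complex). \<integral>\<^sup>+y. f (\<alpha> * x + a * z, \<beta> * x + \<gamma> * y + b * z) \<partial>cgauss)"
  have [measurable]: "g \<in> borel_measurable (borel \<Otimes>\<^sub>M borel)"
    unfolding g_def by measurable
  have "(\<integral>\<^sup>+z. bigauss p q r (\<lambda>(u, v). f (u + complex_of_real a * z, v + complex_of_real b * z)) \<partial>cgauss) =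
     (\<integral>\<^sup>+z. \<integral>\<^sup>+x. g (x, z) \<partial>cgauss \<partial>cgauss)"
    unfolding bigauss_def g_def \<alpha>_def \<beta>_def \<gamma>_def by simp
  also have "\<dots> = (\<integral>\<^sup>+x. \<integral>\<^sup>+z. g (x, z) \<partial>cgauss \<partial>cgauss)"
    by (rule cgauss_pair.Fubini') measurable
  also have "\<dots> = bigauss P Q R f"
  proof (cases "P = 0")
    \<comment> \<open>The first component vanishes identically, so there is no direction to rotate
      onto; the second component is a single Gaussian combination.\<close>
    case True
    then have 0: "p = 0" "a = 0" "q = 0" "\<alpha> = 0" "\<beta> = 0" "\<gamma> = sqrt r" "Q = 0"
      using pqr by (auto simp: P_def Q_def \<alpha>_def \<beta>_def \<gamma>_def add_nonneg_eq_0_iff)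
    have "(\<integral>\<^sup>+z. g (x, z) \<partial>cgauss) = (\<integral>\<^sup>+z. f (0, sqrt R * z) \<partial>cgauss)" for x
      using nn_integral_cgauss_combine[of "\<lambda>z. f (0, z)" b "sqrt r"] pqr
      by (simp add: g_def 0 R_def algebra_simps)
    then show ?thesis
      unfolding bigauss_def True 0 by simp
  next
    case False
    define A where "A = sqrt P"
    have P: "P > 0" "P \<ge> 0" using False pqr by (auto simp: P_def intro: add_nonneg_nonneg less_le[THEN iffD2])
    then have A: "A \<noteq> 0" "A\<^sup>2 = P" by (auto simp: A_def)
    \<comment> \<open>The unit vector along the coefficients of \<open>x\<close> and
      \<open>z\<close> in the first component: after rotation that component no longer contains
      \<open>z\<close> (\<open>e2\<close>).\<close>
    define c s where "c = \<alpha> / A" and "s = a / A"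
    have cs: "c\<^sup>2 + s\<^sup>2 = 1"
      using A coeffs False by (simp add: c_def s_def power_divide P_def add_divide_distrib[symmetric])
    have e1: "\<alpha> * c + a * s = A"
      using A by (simp add: c_def s_def field_simps power2_eq_square[symmetric] coeffs P_def)
    have e2: "a * c = \<alpha> * s"
      by (simp add: c_def s_def)
    have e3: "\<beta> * c + b * s = Q / A"
      using A coeffs(2) by (simp add: c_def s_def field_simps Q_def)
    \<comment> \<open>The residual variance follows from the Pythagorean identity for the rotated
      vector \<open>(\<beta>, b)\<close>: its component along the new axis is \<open>Q / A\<close>,
      and the rest is what remains for \<open>z\<close>.\<close>
    have e4: "(b * c - \<beta> * s)\<^sup>2 + \<gamma>\<^sup>2 = R - Q\<^sup>2 / P"
    proof -
      have "(b * c - \<beta> * s)\<^sup>2 + (\<beta> * c + b * s)\<^sup>2 = (b\<^sup>2 + \<beta>\<^sup>2) * (c\<^sup>2 + s\<^sup>2)"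
        by (simp add: power2_eq_square algebra_simps)
      then show ?thesis
        using coeffs(3) A by (simp add: cs e3 power_divide R_def)
    qed
    have "(\<integral>\<^sup>+x. \<integral>\<^sup>+z. g (x, z) \<partial>cgauss \<partial>cgauss) =
        (\<integral>\<^sup>+x. \<integral>\<^sup>+z. g (c * x - s * z, s * x + c * z) \<partial>cgauss \<partial>cgauss)"
      by (rule nn_integral_cgauss_rotation[OF _ cs, symmetric]) measurable
    also have "\<dots> = (\<integral>\<^sup>+x. \<integral>\<^sup>+z. \<integral>\<^sup>+y. f (complex_of_real A * x, complex_of_real (Q / A) * x + (complex_of_real (b * c - \<beta> * s) * z + complex_of_real \<gamma> * y)) \<partial>cgauss \<partial>cgauss \<partial>cgauss)"
    proof (intro nn_integral_cong)
      fix x z :: complex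
      have "complex_of_real \<alpha> * (c * x - s * z) + a * (s * x + c * z) =
          complex_of_real (\<alpha> * c + a * s) * x + complex_of_real (a * c - \<alpha> * s) * z"
        by (simp add: algebra_simps)
      then have 1: "complex_of_real \<alpha> * (c * x - s * z) + a * (s * x + c * z) = A * x"
        unfolding e1 e2 by simp
      have 2: "complex_of_real \<beta> * (c * x - s * z) + \<gamma> * y + b * (s * x + c * z) =
           complex_of_real (Q / A) * x + (complex_of_real (b * c - \<beta> * s) * z + complex_of_real \<gamma> * y)" for y :: complex
        unfolding e3[symmetric] by (simp add: algebra_simps)
      show "g (c * x - s * z, s * x + c * z) = (\<integral>\<^sup>+y. f (complex_of_real A * x, complex_of_real (Q / A) * x + (complex_of_real (b * c - \<beta> * s) * z + complex_of_real \<gamma> * y)) \<partial>cgauss)"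
        unfolding g_def prod.case 1 2 by simp
    qed
    also have "\<dots> = (\<integral>\<^sup>+x. \<integral>\<^sup>+y. f (complex_of_real A * x, complex_of_real (Q / A) * x + complex_of_real (sqrt (R - Q\<^sup>2 / P)) * y) \<partial>cgauss \<partial>cgauss)"
    proof (rule nn_integral_cong)
      fix x :: complex
      show "(\<integral>\<^sup>+z. \<integral>\<^sup>+y. f (complex_of_real A * x, complex_of_real (Q / A) * x + (complex_of_real (b * c - \<beta> * s) * z + complex_of_real \<gamma> * y)) \<partial>cgauss \<partial>cgauss) =
        (\<integral>\<^sup>+y. f (complex_of_real A * x, complex_of_real (Q / A) * x + complex_of_real (sqrt (R - Q\<^sup>2 / P)) * y) \<partial>cgauss)"
        using nn_integral_cgauss_combine[of "\<lambda>w. f (complex_of_real A * x, complex_of_real (Q / A) * x + w)" "b * c - \<beta> * s" \<gamma>] unfolding e4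
        by simp
    qed
    also have "\<dots> = bigauss P Q R f"
      by (simp add: bigauss_def A_def)
    finally show ?thesis .
  qed
  finally show ?thesis by (simp add: P_def Q_def R_def)
qed

lemma bigauss_0: "bigauss 0 0 0 f = f (0, 0)"
  by (simp add: bigauss_def)

lemma bigauss_measurable [measurable]:
  assumes [measurable]: "(\<lambda>(x, p). f x p) \<in> borel_measurable (M \<Otimes>\<^sub>M (borel \<Otimes>\<^sub>M borel))"
  shows "(\<lambda>x. bigauss p q r (f x)) \<in> borel_measurable M"
  unfolding bigauss_def by measurable

text \<open>By AM-GM the cross term is at most \<open>p b^2 + r a^2\<close>. This propagates the
  side conditions of \<open>bigauss_step\<close> when several steps are chained.\<close>

lemma Cauchy_Schwarz_step:
  fixes p q r a b :: real
  assumes "0 \<le> p" "0 \<le> r" "q\<^sup>2 \<le> p * r"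
  shows "0 \<le> p + a\<^sup>2" "0 \<le> r + b\<^sup>2" "(q + a * b)\<^sup>2 \<le> (p + a\<^sup>2) * (r + b\<^sup>2)"
proof -
  have "(2 * q * (a * b))\<^sup>2 \<le> (p * b\<^sup>2 + r * a\<^sup>2)\<^sup>2"
  proof -
    have "(2 * q * (a * b))\<^sup>2 = 4 * q\<^sup>2 * (a\<^sup>2 * b\<^sup>2)"
      by (simp add: power_mult_distrib)
    also have "\<dots> \<le> 4 * (p * r) * (a\<^sup>2 * b\<^sup>2)"
      using assms by (intro mult_right_mono mult_left_mono) auto
    also have "\<dots> \<le> (p * b\<^sup>2 + r * a\<^sup>2)\<^sup>2"
      using zero_le_power2[of "p * b\<^sup>2 - r * a\<^sup>2"] by (simp add: power2_eq_square algebra_simps)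
    finally show ?thesis .
  qed
  then have "2 * q * (a * b) \<le> p * b\<^sup>2 + r * a\<^sup>2"
    by (rule power2_le_imp_le) (use assms in auto)
  then show "(q + a * b)\<^sup>2 \<le> (p + a\<^sup>2) * (r + b\<^sup>2)"
    using assms by (simp add: power2_eq_square algebra_simps)
qed (use assms in auto)

text \<open>Induction on the index set, starting from the degenerate pair
  \<open>bigauss 0 0 0\<close>: each new coordinate loses its phase by unit invariance and then
  enters through \<open>bigauss_step\<close>.\<close>

lemma nn_integral_PiM_cgauss_pair:
  fixes a b :: "'i \<Rightarrow> real" and u :: "'i \<Rightarrow> complex"
  assumes "finite I" and "\<And>k. k \<in> I \<Longrightarrow> norm (u k) = 1" and "f \<in> borel_measurable (borel \<Otimes>\<^sub>M borel)"
  shows "(\<integral>\<^sup>+X. f (\<Sum>k\<in>I. a k * (u k * X k), \<Sum>k\<in>I. b k * (u k * X k)) \<partial>Pi\<^sub>M I (\<lambda>_. cgauss)) =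
    bigauss (\<Sum>k\<in>I. (a k)\<^sup>2) (\<Sum>k\<in>I. a k * b k) (\<Sum>k\<in>I. (b k)\<^sup>2) f"
  using assms
proof (induction I arbitrary: f rule: finite_induct)
  case empty
  then show ?case
    by (simp add: bigauss_0 nn_integral_count_space_finite PiM_empty)
next
  case (insert i I)
  note [measurable] = insert.prems(2)
  interpret product_sigma_finite "\<lambda>_. cgauss" ..
  define p q r where "p = (\<Sum>k\<in>I. (a k)\<^sup>2)" and "q = (\<Sum>k\<in>I. a k * b k)" and "r = (\<Sum>k\<in>I. (b k)\<^sup>2)"
  have pqr: "0 \<le> p" "0 \<le> r" "q\<^sup>2 \<le> p * r"
    by (auto simp: p_def q_def r_def Cauchy_Schwarz_ineq_sum intro: sum_nonneg)
  have *: "(\<Sum>k\<in>insert i I. c k * (u k * (X(i := y)) k)) = (\<Sum>k\<in>I. c k * (u k * X k)) + c i * (u i * y)"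
    for c :: "'i \<Rightarrow> complex" and X y
  proof -
    have "(\<Sum>k\<in>I. c k * (u k * (X(i := y)) k)) = (\<Sum>k\<in>I. c k * (u k * X k))"
      using insert.hyps by (intro sum.cong) auto
    then show ?thesis using insert.hyps by simp
  qed
  have "(\<integral>\<^sup>+X. f (\<Sum>k\<in>insert i I. a k * (u k * X k), \<Sum>k\<in>insert i I. b k * (u k * X k)) \<partial>Pi\<^sub>M (insert i I) (\<lambda>_. cgauss)) =
    (\<integral>\<^sup>+y. \<integral>\<^sup>+X. f (\<Sum>k\<in>insert i I. a k * (u k * (X(i := y)) k), \<Sum>k\<in>insert i I. b k * (u k * (X(i := y)) k))
       \<partial>Pi\<^sub>M I (\<lambda>_. cgauss) \<partial>cgauss)"
    using insert.hyps by (intro product_nn_integral_insert_rev) auto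
  also have "\<dots> = (\<integral>\<^sup>+y. bigauss p q r (\<lambda>(v, w). f (v + a i * (u i * y), w + b i * (u i * y))) \<partial>cgauss)"
    using insert.IH[of "\<lambda>(v, w). f (v + a i * (u i * y), w + b i * (u i * y))" for y] insert.prems(1)
    unfolding * by (simp add: p_def q_def r_def)
  also have "\<dots> = (\<integral>\<^sup>+y. bigauss p q r (\<lambda>(v, w). f (v + a i * y, w + b i * y)) \<partial>cgauss)"
    using insert.prems(1)[of i]
    by (intro nn_integral_cgauss_unit[where f = "\<lambda>y. bigauss p q r (\<lambda>(v, w). f (v + a i * y, w + b i * y))"]) auto
  also have "\<dots> = bigauss (p + (a i)\<^sup>2) (q + a i * b i) (r + (b i)\<^sup>2) f"
    by (rule bigauss_step) (use pqr in auto)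
  finally show ?case
    using insert.hyps by (simp add: p_def q_def r_def add.commute)
qed

lemma nn_integral_cgauss_linear2:
  fixes a b c d :: real
  assumes [measurable]: "f \<in> borel_measurable (borel \<Otimes>\<^sub>M borel)"
  shows "(\<integral>\<^sup>+x. \<integral>\<^sup>+y. f (a * x + b * y, c * x + d * y) \<partial>cgauss \<partial>cgauss) =
    bigauss (a\<^sup>2 + b\<^sup>2) (a * c + b * d) (c\<^sup>2 + d\<^sup>2) f"
proof -
  have "(\<integral>\<^sup>+y. f (a * x + b * y, c * x + d * y) \<partial>cgauss) =
      bigauss (b\<^sup>2) (b * d) (d\<^sup>2) (\<lambda>(u, v). f (u + a * x, v + c * x))" for x :: complex
    using bigauss_step[of "\<lambda>(u, v). f (u + a * x, v + c * x)" 0 0 0 b d]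
    by (simp add: bigauss_0 add.commute)
  then show ?thesis
    using bigauss_step[of f "b\<^sup>2" "d\<^sup>2" "b * d" a c] by (simp add: power_mult_distrib add.commute)
qed

text \<open>The shape met after conditioning: \<open>x\<close> and \<open>y\<close> are shared by
  both components, while \<open>w\<close> and \<open>z\<close> are residual noise private to one of
  them.\<close>

lemma nn_integral_cgauss_linear4:
  fixes a b c a' b' c' :: real
  assumes [measurable]: "f \<in> borel_measurable (borel \<Otimes>\<^sub>M borel)"
  shows "(\<integral>\<^sup>+x. \<integral>\<^sup>+y. \<integral>\<^sup>+z. \<integral>\<^sup>+w. f (a * x + b * y + c * w, a' * x + b' * y + c' * z)
      \<partial>cgauss \<partial>cgauss \<partial>cgauss \<partial>cgauss) =
    bigauss (a\<^sup>2 + b\<^sup>2 + c\<^sup>2) (a * a' + b * b') (a'\<^sup>2 + b'\<^sup>2 + c'\<^sup>2) f"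
proof -
  have "(\<integral>\<^sup>+z. \<integral>\<^sup>+w. f (a * x + b * y + c * w, a' * x + b' * y + c' * z) \<partial>cgauss \<partial>cgauss) =
     bigauss (c\<^sup>2) 0 (c'\<^sup>2) (\<lambda>(u, v). f (u + a * x + b * y, v + a' * x + b' * y))" for x y :: complex
    using nn_integral_cgauss_linear2[of "\<lambda>(u, v). f (u + a * x + b * y, v + a' * x + b' * y)" 0 c c' 0]
    by (simp add: add_ac)
  moreover have "(\<integral>\<^sup>+y. bigauss (c\<^sup>2) 0 (c'\<^sup>2) (\<lambda>(u, v). f (u + a * x + b * y, v + a' * x + b' * y)) \<partial>cgauss) =
      bigauss (c\<^sup>2 + b\<^sup>2) (b * b') (c'\<^sup>2 + b'\<^sup>2) (\<lambda>(u, v). f (u + a * x, v + a' * x))" for x :: complex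
    using bigauss_step[of "\<lambda>(u, v). f (u + a * x, v + a' * x)" "c\<^sup>2" "c'\<^sup>2" 0 b b']
    by (simp add: add_ac)
  moreover have "(\<integral>\<^sup>+x. bigauss (c\<^sup>2 + b\<^sup>2) (b * b') (c'\<^sup>2 + b'\<^sup>2) (\<lambda>(u, v). f (u + a * x, v + a' * x)) \<partial>cgauss) =
      bigauss (c\<^sup>2 + b\<^sup>2 + a\<^sup>2) (b * b' + a * a') (c'\<^sup>2 + b'\<^sup>2 + a'\<^sup>2) f"
    using Cauchy_Schwarz_step(3)[of "c\<^sup>2" "c'\<^sup>2" 0 b b'] by (intro bigauss_step) auto
  ultimately show ?thesis
    by (simp add: add_ac)
qed

section \<open>Expectation of the Jacobian\<close>

text \<open>A disc of squared radius \<open>t\<close> has area \<open>pi t\<close>, so the squared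
  modulus carries planar measure to pi times length. Using the square avoids any polar
  Jacobian.\<close>

lemma nn_integral_lborel_complex_radial:
  assumes [measurable]: "f \<in> borel_measurable borel"
  shows "(\<integral>\<^sup>+z. f ((norm (z::complex))\<^sup>2) \<partial>lborel) = (\<integral>\<^sup>+t. ennreal pi * f t * indicator {0..} t \<partial>lborel)"
proof -
  let ?h = "\<lambda>z::complex. - ((norm z)\<^sup>2)"
  \<comment> \<open>The reflected radius has finite mass on every half line, as the uniqueness lemma requires.\<close>
  have eq: "distr lborel borel ?h = density lborel (\<lambda>t. ennreal pi * indicator {..0} t)"
  proof (rule measure_eqI_lessThan)
    fix x :: real
    have l: "emeasure (distr lborel borel ?h) {x<..} = ennreal (pi * max 0 (- x))"
    proof -
      have "emeasure (distr lborel borel ?h) {x<..} = emeasure lborel {z. ?h z > x}"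
        by (subst emeasure_distr) (auto intro!: arg_cong2[where f = emeasure])
      also have "{z. ?h z > x} = ball 0 (sqrt (max 0 (-x)))"
      proof (cases "x < 0")
        case True
        then have "norm z < sqrt (max 0 (-x)) \<longleftrightarrow> (norm z)\<^sup>2 < - x" for z :: complex
          using real_less_lsqrt real_less_rsqrt by (metis max.absorb2 less_imp_le neg_0_le_iff_le norm_ge_zero real_sqrt_less_iff real_sqrt_abs abs_norm_cancel)
        then show ?thesis by auto
      next
        case False
        then have "\<not> ?h z > x" for z
          by (smt (verit) zero_le_power2)
        with False show ?thesis by auto
      qed
      also have "emeasure lborel (ball (0::complex) (sqrt (max 0 (-x)))) = ennreal (pi * max 0 (- x))"
        by (subst emeasure_ball) (auto simp: unit_ball_vol_2)
      finally show ?thesis .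
    qed
    then show "emeasure (distr lborel borel ?h) {x<..} < \<infinity>" by simp
    have "emeasure (density lborel (\<lambda>t. ennreal pi * indicator {..0} t)) {x<..} =
        (\<integral>\<^sup>+t. ennreal pi * indicator {x<..0} t \<partial>lborel)"
      by (subst emeasure_density) (auto intro!: nn_integral_cong split: split_indicator)
    also have "\<dots> = ennreal pi * emeasure lborel {x<..0}"
      by (subst nn_integral_cmult) auto
    also have "\<dots> = ennreal (pi * max 0 (- x))"
      by (cases "x \<le> 0") (auto simp: ennreal_mult[symmetric])
    finally show "emeasure (distr lborel borel ?h) {x<..} = emeasure (density lborel (\<lambda>t. ennreal pi * indicator {..0} t)) {x<..}"
      using l by simp
  qed auto
  have "(\<integral>\<^sup>+z. f ((norm (z::complex))\<^sup>2) \<partial>lborel) = (\<integral>\<^sup>+t. f (- t) \<partial>distr lborel borel ?h)"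
    by (subst nn_integral_distr) auto
  also have "\<dots> = (\<integral>\<^sup>+t. ennreal pi * indicator {..0} t * f (- t) \<partial>lborel)"
    unfolding eq by (subst nn_integral_density) auto
  also have "\<dots> = (\<integral>\<^sup>+t. ennreal pi * f t * indicator {0..} t \<partial>lborel)"
    by (subst nn_integral_real_affine[where c = "-1" and t = 0])
       (auto intro!: nn_integral_cong split: split_indicator)
  finally show ?thesis .
qed

lemma nn_integral_cgauss_radial:
  assumes [measurable]: "f \<in> borel_measurable borel"
  shows "(\<integral>\<^sup>+z. f ((norm z)\<^sup>2) \<partial>cgauss) = (\<integral>\<^sup>+t. ennreal (exp (- t)) * f t * indicator {0..} t \<partial>lborel)"
proof -
  have "(\<integral>\<^sup>+z. f ((norm z)\<^sup>2) \<partial>cgauss) = (\<integral>\<^sup>+z. ennreal (exp (- (norm (z::complex))\<^sup>2) / pi) * f ((norm z)\<^sup>2) \<partial>lborel)"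
    by (subst nn_integral_cgauss) (auto simp: gauss_density_def)
  also have "\<dots> = (\<integral>\<^sup>+t. ennreal pi * (ennreal (exp (- t) / pi) * f t) * indicator {0..} t \<partial>lborel)"
    by (rule nn_integral_lborel_complex_radial) auto
  also have "\<dots> = (\<integral>\<^sup>+t. ennreal (exp (- t)) * f t * indicator {0..} t \<partial>lborel)"
    by (simp add: mult.assoc[symmetric] ennreal_mult[symmetric])
  finally show ?thesis .
qed

text \<open>Since \<open>ennreal\<close> sends negative reals to 0, the integrand is the positive
  part of \<open>t - s\<close>, and the value is the mean excess of an exponential variable over the
  level \<open>s\<close>.\<close>

lemma nn_integral_exp_excess:
  assumes "0 \<le> s"
  shows "(\<integral>\<^sup>+t. ennreal (exp (- t)) * ennreal (t - s) * indicator {0..} t \<partial>lborel) = ennreal (exp (- s))"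
proof -
  have "(\<integral>\<^sup>+t. ennreal (exp (- t)) * ennreal (t - s) * indicator {0..} t \<partial>lborel) =
      (\<integral>\<^sup>+t. ennreal ((t - s) * exp (- t)) * indicator {s..} t \<partial>lborel)"
    using assms by (intro nn_integral_cong)
      (auto split: split_indicator simp: ennreal_mult[symmetric] mult.commute ennreal_neg)
  also have "\<dots> = ennreal (0 - (- (s - s + 1) * exp (- s)))"
  proof (rule nn_integral_FTC_atLeast[where F = "\<lambda>t. - (t - s + 1) * exp (- t)"])
    show "((\<lambda>t. - (t - s + 1) * exp (- t)) \<longlongrightarrow> 0) at_top"
      by real_asymp
    show "((\<lambda>t. - (t - s + 1) * exp (- t)) has_real_derivative (t - s) * exp (- t)) (at t)" for t
      by (auto intro!: derivative_eq_intros simp: algebra_simps)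
  qed auto
  finally show ?thesis by simp
qed

text \<open>The squared moduli are independent standard exponentials. Each of the two positive parts
  of the difference has mean \<open>E exp(-T) = 1/2\<close>, and symmetry adds them up.\<close>

lemma nn_integral_cgauss_abs_diff_norms:
  "(\<integral>\<^sup>+x. \<integral>\<^sup>+y. ennreal \<bar>(norm x)\<^sup>2 - (norm y)\<^sup>2\<bar> \<partial>cgauss \<partial>cgauss) = 1"
proof -
  let ?F = "\<lambda>x y. ennreal ((norm (y::complex))\<^sup>2 - (norm (x::complex))\<^sup>2)"
  have inner: "(\<integral>\<^sup>+y. ?F x y \<partial>cgauss) = ennreal (exp (- (norm x)\<^sup>2))" for x
    using nn_integral_cgauss_radial[of "\<lambda>t. ennreal (t - (norm x)\<^sup>2)"]
    by (simp add: nn_integral_exp_excess)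
  have half: "(\<integral>\<^sup>+x. \<integral>\<^sup>+y. ?F x y \<partial>cgauss \<partial>cgauss) = ennreal (1/2)"
  proof -
    have "(\<integral>\<^sup>+x. \<integral>\<^sup>+y. ?F x y \<partial>cgauss \<partial>cgauss) =
        (\<integral>\<^sup>+t. ennreal (exp (- t)) * ennreal (exp (- t)) * indicator {0..} t \<partial>lborel)"
      unfolding inner by (rule nn_integral_cgauss_radial) auto
    also have "\<dots> = (\<integral>\<^sup>+t. ennreal (exp (- 2 * t)) * indicator {0..} t \<partial>lborel)"
      by (simp add: ennreal_mult[symmetric] exp_add[symmetric])
    also have "\<dots> = ennreal (0 - (- exp (- 2 * 0) / 2))"
    proof (rule nn_integral_FTC_atLeast[where F = "\<lambda>t. - exp (- 2 * t) / 2"])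
      show "((\<lambda>t. - exp (- 2 * t) / 2 :: real) \<longlongrightarrow> 0) at_top" by real_asymp
      show "((\<lambda>t. - exp (- 2 * t) / 2) has_real_derivative exp (- 2 * t)) (at t)" for t :: real
        by (auto intro!: derivative_eq_intros)
    qed auto
    finally show ?thesis by simp
  qed
  have "(\<integral>\<^sup>+x. \<integral>\<^sup>+y. ennreal \<bar>(norm x)\<^sup>2 - (norm y)\<^sup>2\<bar> \<partial>cgauss \<partial>cgauss) =
      (\<integral>\<^sup>+x. \<integral>\<^sup>+y. ?F x y + ?F y x \<partial>cgauss \<partial>cgauss)"
  proof -
    have "ennreal \<bar>p - q\<bar> = ennreal (q - p) + ennreal (p - q)" for p q :: real
      by (cases "p \<le> q") (auto simp: ennreal_neg)
    then show ?thesis by simp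
  qed
  also have "\<dots> = (\<integral>\<^sup>+x. \<integral>\<^sup>+y. ?F x y \<partial>cgauss \<partial>cgauss) + (\<integral>\<^sup>+x. \<integral>\<^sup>+y. ?F y x \<partial>cgauss \<partial>cgauss)"
    by (simp add: nn_integral_add)
  also have "(\<integral>\<^sup>+x. \<integral>\<^sup>+y. ?F y x \<partial>cgauss \<partial>cgauss) = (\<integral>\<^sup>+y. \<integral>\<^sup>+x. ?F y x \<partial>cgauss \<partial>cgauss)"
    by (rule cgauss_pair.Fubini') measurable
  finally show ?thesis
    unfolding half by (subst (asm) ennreal_plus[symmetric]) simp_all
qed

text \<open>The matrix with rows \<open>(C, S)\<close> and \<open>(S, C)\<close> is a square root of
  the covariance matrix, with \<open>C + S\<close> and \<open>C - S\<close> the roots of the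
  eigenvalues \<open>g + h\<close> and \<open>g - h\<close>. It is also a multiple of a hyperbolic
  rotation, so it scales the form \<open>|x|^2 - |y|^2\<close> by \<open>C^2 - S^2\<close>. Both
  properties together rest on the two variances being equal.\<close>

lemma bigauss_abs_diff_norms:
  assumes "\<bar>h\<bar> \<le> g"
  shows "bigauss g h g (\<lambda>(u, v). ennreal \<bar>(norm u)\<^sup>2 - (norm v)\<^sup>2\<bar>) = ennreal (sqrt ((g + h) * (g - h)))"
proof -
  define C S where "C = (sqrt (g + h) + sqrt (g - h)) / 2" and "S = (sqrt (g + h) - sqrt (g - h)) / 2"
  have nn: "0 \<le> g + h" "0 \<le> g - h" using assms by auto
  then have sq: "sqrt (g + h) * sqrt (g + h) = g + h" "sqrt (g - h) * sqrt (g - h) = g - h"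
    by simp_all
  have CS: "C\<^sup>2 + S\<^sup>2 = g" "C * S + S * C = h" "C\<^sup>2 - S\<^sup>2 = sqrt ((g + h) * (g - h))"
    unfolding C_def S_def power2_eq_square real_sqrt_mult using sq
    by (simp_all add: field_simps)
  have "bigauss g h g (\<lambda>(u, v). ennreal \<bar>(norm u)\<^sup>2 - (norm v)\<^sup>2\<bar>) =
      (\<integral>\<^sup>+x. \<integral>\<^sup>+y. ennreal \<bar>(norm (C * x + S * y))\<^sup>2 - (norm (S * x + C * y))\<^sup>2\<bar> \<partial>cgauss \<partial>cgauss)"
    using nn_integral_cgauss_linear2[of "\<lambda>(u, v). ennreal \<bar>(norm u)\<^sup>2 - (norm v)\<^sup>2\<bar>" C S S C] CS
    by (simp add: add.commute[of "S\<^sup>2"])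
  also have "\<dots> = (\<integral>\<^sup>+x. \<integral>\<^sup>+y. ennreal (sqrt ((g + h) * (g - h))) * ennreal \<bar>(norm x)\<^sup>2 - (norm y)\<^sup>2\<bar> \<partial>cgauss \<partial>cgauss)"
  proof (intro nn_integral_cong)
    fix x y :: complex
    have "(norm (C * x + S * y))\<^sup>2 - (norm (S * x + C * y))\<^sup>2 = (C\<^sup>2 - S\<^sup>2) * ((norm x)\<^sup>2 - (norm y)\<^sup>2)"
      unfolding cmod_power2 by (simp add: power2_eq_square algebra_simps)
    then show "ennreal \<bar>(norm (C * x + S * y))\<^sup>2 - (norm (S * x + C * y))\<^sup>2\<bar> =
        ennreal (sqrt ((g + h) * (g - h))) * ennreal \<bar>(norm x)\<^sup>2 - (norm y)\<^sup>2\<bar>"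
      using nn by (simp add: CS abs_mult ennreal_mult[symmetric])
  qed
  also have "\<dots> = ennreal (sqrt ((g + h) * (g - h)))"
    by (simp add: nn_integral_cmult nn_integral_cgauss_abs_diff_norms)
  finally show ?thesis .
qed

text \<open>A product of two centred Gaussian densities is again one, contracted by
  \<open>\<kappa>\<close>. Probabilistically, \<open>\<sigma> x\<close> plus an independent standard
  Gaussian is conditioned to vanish: the prefactor is the density of that sum at 0, and the 1 in
  \<open>1 + \<sigma>^2\<close> is the variance of \<open>A_0\<close>.\<close>

lemma nn_integral_cgauss_weight:
  fixes \<sigma> :: real
  assumes [measurable]: "f \<in> borel_measurable borel"
  shows "(\<integral>\<^sup>+x. ennreal (gauss_density (complex_of_real \<sigma> * x)) * f x \<partial>cgauss) =
    ennreal (1 / (pi * (1 + \<sigma>\<^sup>2))) * (\<integral>\<^sup>+x. f (complex_of_real (1 / sqrt (1 + \<sigma>\<^sup>2)) * x) \<partial>cgauss)"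
proof -
  define \<kappa> where "\<kappa> = sqrt (1 + \<sigma>\<^sup>2)"
  have \<kappa>: "\<kappa> > 0" "\<kappa>\<^sup>2 = 1 + \<sigma>\<^sup>2"
    by (auto simp: \<kappa>_def add_pos_nonneg add_nonneg_nonneg)
  have eq: "gauss_density (complex_of_real (1 / \<kappa>) * x) * gauss_density (complex_of_real \<sigma> * (complex_of_real (1 / \<kappa>) * x)) = gauss_density x / pi" for x :: complex
  proof -
    have "(norm (complex_of_real (1 / \<kappa>) * x))\<^sup>2 + (norm (complex_of_real \<sigma> * (complex_of_real (1 / \<kappa>) * x)))\<^sup>2 = ((1 + \<sigma>\<^sup>2) / \<kappa>\<^sup>2) * (norm x)\<^sup>2"
      using \<kappa>(1) by (simp add: norm_mult norm_divide power_mult_distrib power_divide field_simps)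
    also have "\<dots> = (norm x)\<^sup>2"
      unfolding \<kappa>(2)[symmetric] using \<kappa>(1) by simp
    finally show ?thesis
      by (simp add: gauss_density_def exp_add[symmetric])
  qed
  have "(\<integral>\<^sup>+x. ennreal (gauss_density (complex_of_real \<sigma> * x)) * f x \<partial>cgauss) =
      (\<integral>\<^sup>+x. ennreal (gauss_density x * gauss_density (complex_of_real \<sigma> * x)) * f x \<partial>lborel)"
    by (simp add: nn_integral_cgauss ennreal_mult mult.assoc)
  also have "\<dots> = ennreal (\<bar>1 / \<kappa>\<bar> ^ DIM(complex)) *
      (\<integral>\<^sup>+x. ennreal (gauss_density ((1 / \<kappa>) *\<^sub>R x) * gauss_density (complex_of_real \<sigma> * ((1 / \<kappa>) *\<^sub>R x))) * f ((1 / \<kappa>) *\<^sub>R x) \<partial>lborel)"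
    using \<kappa>(1) by (subst nn_integral_lborel_affine[where t = 0 and c = "1 / \<kappa>"]) auto
  also have "\<bar>1 / \<kappa>\<bar> ^ DIM(complex) = 1 / (1 + \<sigma>\<^sup>2)"
    using \<kappa> by (simp add: power_divide)
  also have "(\<integral>\<^sup>+x. ennreal (gauss_density ((1 / \<kappa>) *\<^sub>R x) * gauss_density (complex_of_real \<sigma> * ((1 / \<kappa>) *\<^sub>R x))) * f ((1 / \<kappa>) *\<^sub>R x) \<partial>lborel) =
      (\<integral>\<^sup>+x. ennreal (1 / pi) * (ennreal (gauss_density x) * f (complex_of_real (1 / \<kappa>) * x)) \<partial>lborel)"
    unfolding scaleR_conv_of_real eq by (simp add: ennreal_mult[symmetric] mult.assoc[symmetric])
  also have "\<dots> = ennreal (1 / pi) * (\<integral>\<^sup>+x. f (complex_of_real (1 / \<kappa>) * x) \<partial>cgauss)"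
    by (subst nn_integral_cmult) (auto simp: nn_integral_cgauss)
  also have "ennreal (1 / (1 + \<sigma>\<^sup>2)) * (ennreal (1 / pi) * (\<integral>\<^sup>+x. f (complex_of_real (1 / \<kappa>) * x) \<partial>cgauss)) =
      ennreal (1 / (pi * (1 + \<sigma>\<^sup>2))) * (\<integral>\<^sup>+x. f (complex_of_real (1 / \<kappa>) * x) \<partial>cgauss)"
    by (simp add: mult.assoc[symmetric] ennreal_mult[symmetric] mult.commute)
  finally show ?thesis by (simp add: \<kappa>_def)
qed

text \<open>The inner pair is the value and \<open>z\<close>-multiplied derivative of
  \<open>p\<close> without \<open>A_0\<close>, the outer pair that of \<open>q\<close>. The constant
  term contributes 1 to \<open>a\<close> and nothing to \<open>b\<close> or \<open>d\<close>, hence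
  \<open>a - 1\<close> in the inner pair only.\<close>

lemma bigauss_kac_rice_density:
  assumes a: "1 \<le> a" and d: "0 \<le> d" and b: "b\<^sup>2 \<le> (a - 1) * d"
  shows "bigauss a b d (\<lambda>(u', v'). bigauss (a - 1) b d (\<lambda>(u, v).
      ennreal (gauss_density (u + cnj u')) * ennreal \<bar>(norm v)\<^sup>2 - (norm v')\<^sup>2\<bar>)) =
    ennreal (sqrt (d * (d - b\<^sup>2 / a)) / (2 * pi * a))"
proof -
  have b': "b\<^sup>2 \<le> a * d"
    using b d by (simp add: algebra_simps)
  define \<alpha> \<beta> \<gamma> where "\<alpha> = sqrt (a - 1)" and "\<beta> = b / sqrt (a - 1)" and "\<gamma> = sqrt (d - b\<^sup>2 / (a - 1))"
  define \<alpha>' \<beta>' \<gamma>' where "\<alpha>' = sqrt a" and "\<beta>' = b / sqrt a" and "\<gamma>' = sqrt (d - b\<^sup>2 / a)"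
  have c1: "\<alpha>\<^sup>2 = a - 1" "\<alpha> * \<beta> = b" "\<beta>\<^sup>2 + \<gamma>\<^sup>2 = d"
    using bigauss_coeffs[of "a - 1" d b] a d b by (simp_all add: \<alpha>_def \<beta>_def \<gamma>_def)
  have c2: "\<alpha>'\<^sup>2 = a" "\<alpha>' * \<beta>' = b" "\<beta>'\<^sup>2 + \<gamma>'\<^sup>2 = d"
    using bigauss_coeffs[of a d b] a d b' by (simp_all add: \<alpha>'_def \<beta>'_def \<gamma>'_def)
  \<comment> \<open>The variance \<open>(a - 1) + a\<close> of \<open>H(z)\<close> without
    \<open>A_0\<close>; the weight later adds 1 and gives \<open>2 a\<close>.\<close>
  define \<sigma> where "\<sigma> = sqrt (2 * a - 1)"
  have \<sigma>: "\<sigma> > 0" "\<sigma>\<^sup>2 = 2 * a - 1" using a by (simp_all add: \<sigma>_def)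
  define c s where "c = \<alpha> / \<sigma>" and "s = \<alpha>' / \<sigma>"
  have cs: "c\<^sup>2 + s\<^sup>2 = 1"
    unfolding c_def s_def power_divide c1 c2 \<sigma>(2) using a by (simp add: divide_simps)
  define D where "D = (\<lambda>(v::complex, v'::complex). ennreal \<bar>(norm v)\<^sup>2 - (norm v')\<^sup>2\<bar>)"
  have [measurable]: "D \<in> borel_measurable (borel \<Otimes>\<^sub>M borel)"
    unfolding D_def by measurable
  define K where "K = (\<lambda>(x', y', x, y). ennreal (gauss_density (complex_of_real \<alpha> * x + complex_of_real \<alpha>' * x')) *
     D (complex_of_real \<beta> * x + complex_of_real \<gamma> * y, complex_of_real \<beta>' * x' + complex_of_real \<gamma>' * y'))"
  have K[measurable]: "K \<in> borel_measurable (borel \<Otimes>\<^sub>M borel \<Otimes>\<^sub>M borel \<Otimes>\<^sub>M borel)"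
    unfolding K_def by measurable
  have "bigauss a b d (\<lambda>(u', v'). bigauss (a - 1) b d (\<lambda>(u, v).
      ennreal (gauss_density (u + cnj u')) * ennreal \<bar>(norm v)\<^sup>2 - (norm v')\<^sup>2\<bar>)) =
     (\<integral>\<^sup>+x'. \<integral>\<^sup>+y'. \<integral>\<^sup>+x. \<integral>\<^sup>+y. K (cnj x', cnj y', x, y) \<partial>cgauss \<partial>cgauss \<partial>cgauss \<partial>cgauss)"
  proof -
    \<comment> \<open>Only the modulus of the second outer component matters, so the conjugation can
      be moved onto \<open>x'\<close> and \<open>y'\<close> and then removed by conjugation
      invariance.\<close>
    have "norm (complex_of_real \<beta>' * cnj x' + complex_of_real \<gamma>' * cnj y') =
        norm (complex_of_real \<beta>' * x' + complex_of_real \<gamma>' * y')" for x' y'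
      using complex_mod_cnj[of "complex_of_real \<beta>' * x' + complex_of_real \<gamma>' * y'"] by simp
    moreover have "bigauss (a - 1) b d f = (\<integral>\<^sup>+x. \<integral>\<^sup>+y. f (\<alpha> * x, \<beta> * x + \<gamma> * y) \<partial>cgauss \<partial>cgauss)"
        "bigauss a b d f = (\<integral>\<^sup>+x. \<integral>\<^sup>+y. f (\<alpha>' * x, \<beta>' * x + \<gamma>' * y) \<partial>cgauss \<partial>cgauss)" for f
      by (simp_all only: bigauss_def \<alpha>_def \<beta>_def \<gamma>_def \<alpha>'_def \<beta>'_def \<gamma>'_def)
    ultimately show ?thesis
      unfolding K_def D_def by simp
  qed
  also have "\<dots> = (\<integral>\<^sup>+x'. \<integral>\<^sup>+y'. \<integral>\<^sup>+x. \<integral>\<^sup>+y. K (cnj x', y', x, y) \<partial>cgauss \<partial>cgauss \<partial>cgauss \<partial>cgauss)"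
    by (intro nn_integral_cong
        nn_integral_cgauss_cnj[where f = "\<lambda>y'. \<integral>\<^sup>+x. \<integral>\<^sup>+y. K (cnj x', y', x, y) \<partial>cgauss \<partial>cgauss" for x'])
       measurable
  also have "\<dots> = (\<integral>\<^sup>+x'. \<integral>\<^sup>+y'. \<integral>\<^sup>+x. \<integral>\<^sup>+y. K (x', y', x, y) \<partial>cgauss \<partial>cgauss \<partial>cgauss \<partial>cgauss)"
    by (rule nn_integral_cgauss_cnj[where f = "\<lambda>x'. \<integral>\<^sup>+y'. \<integral>\<^sup>+x. \<integral>\<^sup>+y. K (x', y', x, y) \<partial>cgauss \<partial>cgauss \<partial>cgauss"])
       measurable
  also have "\<dots> = (\<integral>\<^sup>+x'. \<integral>\<^sup>+x. \<integral>\<^sup>+y'. \<integral>\<^sup>+y. K (x', y', x, y) \<partial>cgauss \<partial>cgauss \<partial>cgauss \<partial>cgauss)"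
    by (intro nn_integral_cong cgauss_pair.Fubini') measurable
  also have "\<dots> = (\<integral>\<^sup>+x. \<integral>\<^sup>+x'. \<integral>\<^sup>+y'. \<integral>\<^sup>+y. K (x', y', x, y) \<partial>cgauss \<partial>cgauss \<partial>cgauss \<partial>cgauss)"
    by (rule cgauss_pair.Fubini') measurable
  \<comment> \<open>After this rotation the argument of the density is \<open>\<sigma> x\<close>
    alone; \<open>w\<close> is the direction left untouched by the conditioning.\<close>
  also have "\<dots> = (\<integral>\<^sup>+x. \<integral>\<^sup>+w. \<integral>\<^sup>+y'. \<integral>\<^sup>+y. K (s * x + c * w, y', c * x - s * w, y) \<partial>cgauss \<partial>cgauss \<partial>cgauss \<partial>cgauss)"
    using nn_integral_cgauss_rotation[OF _ cs, of "\<lambda>(x, x'). \<integral>\<^sup>+y'. \<integral>\<^sup>+y. K (x', y', x, y) \<partial>cgauss \<partial>cgauss"]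
    by simp
  also have "\<dots> = (\<integral>\<^sup>+x. ennreal (gauss_density (\<sigma> * x)) *
      (\<integral>\<^sup>+w. \<integral>\<^sup>+y'. \<integral>\<^sup>+y. D (complex_of_real (\<beta> * c) * x + complex_of_real (- \<beta> * s) * w + complex_of_real \<gamma> * y,
         complex_of_real (\<beta>' * s) * x + complex_of_real (\<beta>' * c) * w + complex_of_real \<gamma>' * y') \<partial>cgauss \<partial>cgauss \<partial>cgauss) \<partial>cgauss)"
  proof (rule nn_integral_cong)
    fix x :: complex
    have e1: "complex_of_real \<alpha> * (c * x - s * w) + complex_of_real \<alpha>' * (s * x + c * w) = \<sigma> * x" for w :: complex
    proof -
      have "complex_of_real \<alpha> * (c * x - s * w) + complex_of_real \<alpha>' * (s * x + c * w) =
          complex_of_real (\<alpha> * c + \<alpha>' * s) * x + complex_of_real (\<alpha>' * c - \<alpha> * s) * w"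
        by (simp add: algebra_simps)
      also have "\<alpha>' * c - \<alpha> * s = 0" by (simp add: c_def s_def)
      also have "\<alpha> * c + \<alpha>' * s = (\<alpha>\<^sup>2 + \<alpha>'\<^sup>2) / \<sigma>" by (simp add: c_def s_def power2_eq_square add_divide_distrib)
      also have "\<alpha>\<^sup>2 + \<alpha>'\<^sup>2 = \<sigma>\<^sup>2" unfolding c1 c2 \<sigma> by simp
      also have "\<sigma>\<^sup>2 / \<sigma> = \<sigma>" using \<sigma>(1) by (simp add: power2_eq_square)
      finally show ?thesis by simp
    qed
    have e2: "complex_of_real \<beta> * (c * x - s * w) + \<gamma> * y =
        complex_of_real (\<beta> * c) * x + complex_of_real (- \<beta> * s) * w + complex_of_real \<gamma> * y"
      "complex_of_real \<beta>' * (s * x + c * w) + \<gamma>' * y =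
         complex_of_real (\<beta>' * s) * x + complex_of_real (\<beta>' * c) * w + complex_of_real \<gamma>' * y" for w y :: complex
      by (simp_all add: algebra_simps)
    show "(\<integral>\<^sup>+w. \<integral>\<^sup>+y'. \<integral>\<^sup>+y. K (s * x + c * w, y', c * x - s * w, y) \<partial>cgauss \<partial>cgauss \<partial>cgauss) =
      ennreal (gauss_density (\<sigma> * x)) *
      (\<integral>\<^sup>+w. \<integral>\<^sup>+y'. \<integral>\<^sup>+y. D (complex_of_real (\<beta> * c) * x + complex_of_real (- \<beta> * s) * w + complex_of_real \<gamma> * y,
         complex_of_real (\<beta>' * s) * x + complex_of_real (\<beta>' * c) * w + complex_of_real \<gamma>' * y') \<partial>cgauss \<partial>cgauss \<partial>cgauss)"
      unfolding K_def prod.case e1 e2 by (simp add: nn_integral_cmult del: of_real_mult of_real_minus)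
  qed
  also have "\<dots> = ennreal (1 / (pi * (1 + \<sigma>\<^sup>2))) *
      (\<integral>\<^sup>+x. \<integral>\<^sup>+w. \<integral>\<^sup>+y'. \<integral>\<^sup>+y. D (complex_of_real (\<beta> * c) * ((1 / sqrt (1 + \<sigma>\<^sup>2)) * x) + complex_of_real (- \<beta> * s) * w + complex_of_real \<gamma> * y,
         complex_of_real (\<beta>' * s) * ((1 / sqrt (1 + \<sigma>\<^sup>2)) * x) + complex_of_real (\<beta>' * c) * w + complex_of_real \<gamma>' * y')
          \<partial>cgauss \<partial>cgauss \<partial>cgauss \<partial>cgauss)"
    by (rule nn_integral_cgauss_weight[where f = "\<lambda>x. (\<integral>\<^sup>+w. \<integral>\<^sup>+y'. \<integral>\<^sup>+y. D (complex_of_real (\<beta> * c) * x + complex_of_real (- \<beta> * s) * w + complex_of_real \<gamma> * y,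
         complex_of_real (\<beta>' * s) * x + complex_of_real (\<beta>' * c) * w + complex_of_real \<gamma>' * y') \<partial>cgauss \<partial>cgauss \<partial>cgauss)"])
       measurable
  also have "1 + \<sigma>\<^sup>2 = 2 * a" using \<sigma> by simp
  also have "(\<integral>\<^sup>+x. \<integral>\<^sup>+w. \<integral>\<^sup>+y'. \<integral>\<^sup>+y. D (complex_of_real (\<beta> * c) * ((1 / sqrt (2 * a)) * x) + complex_of_real (- \<beta> * s) * w + complex_of_real \<gamma> * y,
         complex_of_real (\<beta>' * s) * ((1 / sqrt (2 * a)) * x) + complex_of_real (\<beta>' * c) * w + complex_of_real \<gamma>' * y')
          \<partial>cgauss \<partial>cgauss \<partial>cgauss \<partial>cgauss) =
     bigauss ((\<beta> * c * (1 / sqrt (2 * a)))\<^sup>2 + (- \<beta> * s)\<^sup>2 + \<gamma>\<^sup>2)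
       (\<beta> * c * (1 / sqrt (2 * a)) * (\<beta>' * s * (1 / sqrt (2 * a))) + (- \<beta> * s) * (\<beta>' * c))
       ((\<beta>' * s * (1 / sqrt (2 * a)))\<^sup>2 + (\<beta>' * c)\<^sup>2 + \<gamma>'\<^sup>2) D"
    using nn_integral_cgauss_linear4[of D "\<beta> * c * (1 / sqrt (2 * a))" "- \<beta> * s" \<gamma> "\<beta>' * s * (1 / sqrt (2 * a))" "\<beta>' * c" \<gamma>']
    by (simp add: mult.assoc)
  \<comment> \<open>This and the next two computations are the regression formula: conditioning on a
    variable of variance \<open>2 a\<close> that has covariance \<open>b\<close> with each
    derivative subtracts \<open>b^2/(2a)\<close> from every entry of the covariance matrix.\<close>
  also have "(\<beta> * c * (1 / sqrt (2 * a)))\<^sup>2 + (- \<beta> * s)\<^sup>2 + \<gamma>\<^sup>2 = d - b\<^sup>2 / (2 * a)"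
  proof -
    have "(\<beta> * c)\<^sup>2 = b\<^sup>2 / \<sigma>\<^sup>2"
      by (simp add: c_def power_divide power_mult_distrib c1(2)[symmetric] mult.commute)
    moreover have "(- \<beta> * s)\<^sup>2 = \<beta>\<^sup>2 - (\<beta> * c)\<^sup>2"
      using arg_cong[OF cs, of "\<lambda>x. \<beta>\<^sup>2 * x"] by (simp add: power_mult_distrib distrib_left)
    ultimately have "(\<beta> * c * (1 / sqrt (2 * a)))\<^sup>2 + (- \<beta> * s)\<^sup>2 + \<gamma>\<^sup>2 =
        b\<^sup>2 / \<sigma>\<^sup>2 / (2 * a) - b\<^sup>2 / \<sigma>\<^sup>2 + d"
      using a by (simp add: power_mult_distrib power_divide c1(3)[symmetric])
    also have "\<dots> = d - b\<^sup>2 / (2 * a)"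
      unfolding \<sigma>(2) using a by (simp add: divide_simps) (simp add: algebra_simps)
    finally show ?thesis .
  qed
  also have "(\<beta>' * s * (1 / sqrt (2 * a)))\<^sup>2 + (\<beta>' * c)\<^sup>2 + \<gamma>'\<^sup>2 = d - b\<^sup>2 / (2 * a)"
  proof -
    have "(\<beta>' * s)\<^sup>2 = b\<^sup>2 / \<sigma>\<^sup>2"
      by (simp add: s_def power_divide power_mult_distrib c2(2)[symmetric] mult.commute)
    moreover have "(\<beta>' * c)\<^sup>2 = \<beta>'\<^sup>2 - (\<beta>' * s)\<^sup>2"
      using arg_cong[OF cs, of "\<lambda>x. \<beta>'\<^sup>2 * x"] by (simp add: power_mult_distrib distrib_left)
    ultimately have "(\<beta>' * s * (1 / sqrt (2 * a)))\<^sup>2 + (\<beta>' * c)\<^sup>2 + \<gamma>'\<^sup>2 =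
        b\<^sup>2 / \<sigma>\<^sup>2 / (2 * a) - b\<^sup>2 / \<sigma>\<^sup>2 + d"
      using a by (simp add: power_mult_distrib power_divide c2(3)[symmetric])
    also have "\<dots> = d - b\<^sup>2 / (2 * a)"
      unfolding \<sigma>(2) using a by (simp add: divide_simps) (simp add: algebra_simps)
    finally show ?thesis .
  qed
  also have "\<beta> * c * (1 / sqrt (2 * a)) * (\<beta>' * s * (1 / sqrt (2 * a))) + (- \<beta> * s) * (\<beta>' * c) = - (b\<^sup>2 / (2 * a))"
  proof -
    have "(\<beta> * c) * (\<beta>' * s) = (\<alpha> * \<beta>) * (\<alpha>' * \<beta>') / \<sigma>\<^sup>2"
      by (simp add: c_def s_def power2_eq_square)
    then have eq: "(\<beta> * c) * (\<beta>' * s) = b\<^sup>2 / \<sigma>\<^sup>2"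
      unfolding c1 c2 by (simp add: power2_eq_square)
    have "\<beta> * c * (1 / sqrt (2 * a)) * (\<beta>' * s * (1 / sqrt (2 * a))) + (- \<beta> * s) * (\<beta>' * c) =
        (\<beta> * c) * (\<beta>' * s) * ((1 / sqrt (2 * a)) * (1 / sqrt (2 * a))) - (\<beta> * c) * (\<beta>' * s)"
      by simp
    also have "(1 / sqrt (2 * a)) * (1 / sqrt (2 * a)) = 1 / (2 * a)"
      using a by simp
    also have "(\<beta> * c) * (\<beta>' * s) * (1 / (2 * a)) - (\<beta> * c) * (\<beta>' * s) = - (b\<^sup>2 / (2 * a))"
      unfolding eq \<sigma>(2) using a by (simp add: divide_simps) (simp add: algebra_simps)
    finally show ?thesis .
  qed
  \<comment> \<open>The sum and the difference of variance and covariance are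
    \<open>d - b^2/a\<close> and \<open>d\<close>.\<close>
  also have "bigauss (d - b\<^sup>2 / (2 * a)) (- (b\<^sup>2 / (2 * a))) (d - b\<^sup>2 / (2 * a)) D = ennreal (sqrt (d * (d - b\<^sup>2 / a)))"
  proof -
    have "b\<^sup>2 / (2 * a) + b\<^sup>2 / (2 * a) \<le> d"
      using a b' by (simp add: field_simps)
    moreover have "0 \<le> b\<^sup>2 / (2 * a)" using a by simp
    ultimately have "\<bar>- (b\<^sup>2 / (2 * a))\<bar> \<le> d - b\<^sup>2 / (2 * a)" by linarith
    moreover have "d - b\<^sup>2 / (2 * a) + - (b\<^sup>2 / (2 * a)) = d - b\<^sup>2 / a" using a by (simp add: field_simps)
    ultimately show ?thesis
      unfolding D_def by (subst bigauss_abs_diff_norms) (simp_all add: mult.commute)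
  qed
  also have "ennreal (1 / (pi * (2 * a))) * ennreal (sqrt (d * (d - b\<^sup>2 / a))) =
      ennreal (sqrt (d * (d - b\<^sup>2 / a)) / (2 * pi * a))"
    using a by (subst ennreal_mult'[symmetric]) (simp_all add: mult_ac)
  finally show ?thesis .
qed

section \<open>The area formula\<close>

text \<open>The change of variables theorem concerns absolutely integrable vector-valued functions,
  so \<open>f\<close> is embedded in dimension one by \<open>vec\<close>; integrability of
  \<open>f\<close> makes both sides finite and lets them be read as nonnegative integrals.\<close>

lemma nn_integral_image_inj:
  fixes g :: "real^'n::{finite,wellorder} \<Rightarrow> real^'n::_" and f :: "real^'n::_ \<Rightarrow> real"
  assumes S: "S \<in> sets lebesgue"
    and der: "\<And>x. x \<in> S \<Longrightarrow> (g has_derivative g' x) (at x within S)"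
    and inj: "inj_on g S"
    and f: "integrable lborel f" "\<And>y. 0 \<le> f y"
  shows "g ` S \<in> sets lebesgue"
    and "(\<integral>\<^sup>+y. ennreal (f y) * indicator (g ` S) y \<partial>lebesgue) =
      (\<integral>\<^sup>+x. ennreal (\<bar>det (matrix (g' x))\<bar> * f (g x)) * indicator S x \<partial>lebesgue)"
proof -
  show gS: "g ` S \<in> sets lebesgue"
    using der by (intro differentiable_image_in_sets_lebesgue[OF S])
      (auto simp: differentiable_on_def differentiable_def)
  have "integrable lebesgue f"
    using f(1) by (simp add: integrable_completion)
  then have ai: "f absolutely_integrable_on g ` S"
    unfolding set_integrable_def by (intro integrable_mult_indicator gS)
  let ?D = "\<lambda>x. \<bar>det (matrix (g' x))\<bar> * f (g x)"
  have ai': "?D absolutely_integrable_on S" and eq: "integral S ?D = integral (g ` S) f"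
    using has_absolute_integral_change_of_variables[OF S der inj, of "\<lambda>y. vec (f y) :: real^1" "vec (integral (g ` S) f)"] ai
    by (simp_all add: absolutely_integrable_on_1_iff integral_on_1_eq)
  have *: "(\<integral>\<^sup>+y. ennreal (h y) * indicator A y \<partial>lebesgue) = ennreal (integral A h)"
    if "h absolutely_integrable_on A" "\<And>y. 0 \<le> h y" for h :: "real^'n::_ \<Rightarrow> real" and A
  proof -
    have "(\<integral>\<^sup>+y. ennreal (h y) * indicator A y \<partial>lebesgue) = (\<integral>\<^sup>+y. ennreal (indicator A y *\<^sub>R h y) \<partial>lebesgue)"
      by (intro nn_integral_cong) (auto split: split_indicator)
    also have "\<dots> = ennreal (integral\<^sup>L lebesgue (\<lambda>y. indicator A y *\<^sub>R h y))"
      using that by (intro nn_integral_eq_integral) (auto simp: set_integrable_def)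
    also have "integral\<^sup>L lebesgue (\<lambda>y. indicator A y *\<^sub>R h y) = integral A h"
      using set_lebesgue_integral_eq_integral(2)[OF that(1)] by (simp add: set_lebesgue_integral_def)
    finally show ?thesis .
  qed
  show "(\<integral>\<^sup>+y. ennreal (f y) * indicator (g ` S) y \<partial>lebesgue) =
      (\<integral>\<^sup>+x. ennreal (?D x) * indicator S x \<partial>lebesgue)"
    using *[OF ai] *[OF ai'] f(2) eq by simp
qed

text \<open>Outside the image of the critical set, which is negligible by Sard's lemma,
  the preimages of \<open>y\<close> are counted by the images of countably many disjoint pieces on which \<open>g\<close> is injective.\<close>

theorem area_formula:
  fixes g :: "real^'n::{finite,wellorder} \<Rightarrow> real^'n::_" and f :: "real^'n::_ \<Rightarrow> real"
  assumes der: "\<And>x. (g has_derivative g' x) (at x)"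
    and cont: "\<And>x e. 0 < e \<Longrightarrow> \<exists>d>0. \<forall>y. dist x y < d \<longrightarrow> onorm (\<lambda>v. g' y v - g' x v) < e"
    and f: "integrable lborel f" "\<And>y. 0 \<le> f y"
  shows "(\<integral>\<^sup>+y. ennreal (f y) * emeasure (count_space UNIV) (g -` {y}) \<partial>lborel) =
      (\<integral>\<^sup>+x. ennreal (\<bar>det (matrix (g' x))\<bar> * f (g x)) \<partial>lborel)"
proof -
  let ?J = "\<lambda>x. det (matrix (g' x))"
  define R where "R = {x. ?J x \<noteq> 0}"
  have lin: "linear (g' x)" for x
    using der[of x] has_derivative_linear by blast
  have "?J \<in> borel_measurable (lebesgue_on UNIV)"
    using der by (intro borel_measurable_det_Jacobian) auto
  then have [measurable]: "?J \<in> borel_measurable lebesgue" by (simp add: lebesgue_on_UNIV_eq)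
  have R[measurable]: "R \<in> sets lebesgue"
  proof -
    have "{x \<in> space lebesgue. ?J x \<noteq> 0} \<in> sets lebesgue" by measurable
    then show ?thesis by (simp add: R_def)
  qed
  have neg: "negligible (g ` (- R))"
  proof (rule baby_Sard)
    show "(g has_derivative g' x) (at x within - R)" for x
      using der has_derivative_at_withinI by blast
    show "rank (matrix (g' x)) < CARD('n)" if "x \<in> - R" for x
      using that by (auto simp: R_def det_eq_0_rank)
  qed simp
  \<comment> \<open>The inverse function argument: an invertible derivative that varies continuously
    makes \<open>g\<close> injective near \<open>x\<close>.\<close>
  have "\<exists>r>0. inj_on g (ball x r)" if x: "x \<in> R" for x
  proof -
    have "invertible (matrix (g' x))"
      using x by (simp add: R_def invertible_det_nz)
    then obtain B where B: "B ** matrix (g' x) = mat 1"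
      by (auto simp: invertible_def)
    have "(\<lambda>v. B *v v) \<circ> g' x = id"
    proof
      fix v
      have "B *v g' x v = B *v (matrix (g' x) *v v)"
        using lin by (simp add: matrix_works)
      also have "\<dots> = v"
        by (simp add: matrix_vector_mul_assoc B)
      finally show "((\<lambda>v. B *v v) \<circ> g' x) v = id v" by simp
    qed
    then show ?thesis
      by (rule has_derivative_locally_injective[OF UNIV_I open_UNIV matrix_vector_mul_bounded_linear _ der cont])
         blast+
  qed
  then obtain r where r: "\<And>x. x \<in> R \<Longrightarrow> r x > 0 \<and> inj_on g (ball x (r x))"
    by metis
  \<comment> \<open>Adding the empty set keeps the family nonempty, even when there are no regular
    points, so that it can be enumerated by the naturals.\<close>
  obtain F where F: "F \<subseteq> insert {} ((\<lambda>x. ball x (r x)) ` R)" "countable F"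
      "\<Union>F = \<Union>(insert {} ((\<lambda>x. ball x (r x)) ` R))"
    by (rule Lindelof[of "insert {} ((\<lambda>x. ball x (r x)) ` R)"]) auto
  define U where "U = from_nat_into (insert {} F)"
  have rU: "range U = insert {} F"
    unfolding U_def using F by (intro range_from_nat_into) auto
  have U: "U i = {} \<or> (\<exists>x\<in>R. U i = ball x (r x))" for i
  proof -
    have "U i \<in> insert {} F"
      using rU by blast
    then have "U i \<in> insert {} ((\<lambda>x. ball x (r x)) ` R)"
      using F(1) by blast
    then show ?thesis by blast
  qed
  have injU: "inj_on g (U i)" and openU: "open (U i)" for i
    using U[of i] r by auto
  have RU: "R \<subseteq> (\<Union>i. U i)"
  proof
    fix x assume x: "x \<in> R"
    then have "x \<in> \<Union>F"
      using r[OF x] unfolding F(3) by (auto intro!: bexI[of _ x])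
    then show "x \<in> (\<Union>i. U i)"
      using rU by blast
  qed
  \<comment> \<open>Disjoint pieces of the regular set, so that every preimage is counted exactly
    once.\<close>
  define S where "S i = disjointed U i \<inter> R" for i
  have US: "(\<Union>i. S i) = R"
    using RU UN_disjointed_eq[of U] by (auto simp: S_def)
  have disS: "disjoint_family S"
    using disjoint_family_disjointed[of U] by (auto simp: S_def disjoint_family_on_def)
  have mS[measurable]: "S i \<in> sets lebesgue" for i
  proof -
    have "range U \<subseteq> sets lebesgue"
      using openU by auto
    from sets.range_disjointed_sets[OF this] show ?thesis
      by (auto simp: S_def)
  qed
  have injS: "inj_on g (S i)" for i
    by (rule inj_on_subset[OF injU[of i]]) (use disjointed_subset[of U i] in \<open>auto simp: S_def\<close>)
  have der': "(g has_derivative g' x) (at x within A)" for x A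
    using der has_derivative_at_withinI by blast
  note img = nn_integral_image_inj[OF mS der' injS f]
  note [measurable] = img(1)
  have [measurable]: "f \<in> borel_measurable lebesgue"
    using f(1) by (auto intro: measurable_completion)
  have count: "emeasure (count_space UNIV) (g -` {y}) = (\<Sum>i. indicator (g ` S i) y)" if y: "y \<notin> g ` (- R)" for y
  proof -
    have "g -` {y} = (\<Union>i. g -` {y} \<inter> S i)"
      using y US by auto
    then have "emeasure (count_space UNIV) (g -` {y}) = emeasure (count_space UNIV) (\<Union>i. g -` {y} \<inter> S i)"
      by simp
    also have "\<dots> = (\<Sum>i. emeasure (count_space UNIV) (g -` {y} \<inter> S i))"
      using disS by (intro suminf_emeasure[symmetric]) (auto simp: disjoint_family_on_def)
    also have "(\<lambda>i. emeasure (count_space UNIV) (g -` {y} \<inter> S i)) = (\<lambda>i. indicator (g ` S i) y)"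
    proof (rule ext)
      fix i
      show "emeasure (count_space UNIV) (g -` {y} \<inter> S i) = indicator (g ` S i) y"
      proof (cases "y \<in> g ` S i")
        case True
        then obtain x where "x \<in> S i" "g x = y" by auto
        then have "g -` {y} \<inter> S i = {x}"
          using injS[of i] by (auto simp: inj_on_def)
        with True show ?thesis by simp
      next
        case False
        then have "g -` {y} \<inter> S i = {}" by auto
        with False show ?thesis by simp
      qed
    qed
    finally show ?thesis .
  qed
  have "(\<integral>\<^sup>+y. ennreal (f y) * emeasure (count_space UNIV) (g -` {y}) \<partial>lborel) =
      (\<integral>\<^sup>+y. ennreal (f y) * emeasure (count_space UNIV) (g -` {y}) \<partial>lebesgue)"
    by (simp add: nn_integral_completion)
  also have "\<dots> = (\<integral>\<^sup>+y. (\<Sum>i. ennreal (f y) * indicator (g ` S i) y) \<partial>lebesgue)"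
  proof (rule nn_integral_cong_AE)
    have "AE y in lebesgue. y \<notin> g ` (- R)"
      using neg by (intro AE_not_in) (simp add: negligible_iff_null_sets)
    then show "AE y in lebesgue. ennreal (f y) * emeasure (count_space UNIV) (g -` {y}) =
        (\<Sum>i. ennreal (f y) * indicator (g ` S i) y)"
      by eventually_elim (simp add: count)
  qed
  also have "\<dots> = (\<Sum>i. \<integral>\<^sup>+y. ennreal (f y) * indicator (g ` S i) y \<partial>lebesgue)"
    by (rule nn_integral_suminf) measurable
  also have "\<dots> = (\<Sum>i. \<integral>\<^sup>+x. ennreal (\<bar>?J x\<bar> * f (g x)) * indicator (S i) x \<partial>lebesgue)"
    by (simp add: img(2))
  also have "\<dots> = (\<integral>\<^sup>+x. (\<Sum>i. ennreal (\<bar>?J x\<bar> * f (g x)) * indicator (S i) x) \<partial>lebesgue)"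
  proof (rule nn_integral_suminf[symmetric])
    have "continuous_on UNIV g"
      using der has_derivative_continuous continuous_at_imp_continuous_on by blast
    then have "g \<in> borel_measurable borel"
      by (rule borel_measurable_continuous_onI)
    moreover have "f \<in> borel_measurable borel" using f(1) by auto
    ultimately have "(\<lambda>x. f (g x)) \<in> borel_measurable lborel"
      by simp
    then have [measurable]: "(\<lambda>x. f (g x)) \<in> borel_measurable lebesgue"
      by (rule measurable_completion)
    show "(\<lambda>x. ennreal (\<bar>?J x\<bar> * f (g x)) * indicator (S i) x) \<in> borel_measurable lebesgue" for i
      by measurable
  qed
  also have "\<dots> = (\<integral>\<^sup>+x. ennreal (\<bar>?J x\<bar> * f (g x)) \<partial>lebesgue)"
  proof (rule nn_integral_cong)
    fix x
    have "(\<Sum>i. ennreal (\<bar>?J x\<bar> * f (g x)) * indicator (S i) x) = ennreal (\<bar>?J x\<bar> * f (g x)) * indicator (\<Union>i. S i) x"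
      using suminf_indicator[OF disS, of x] by simp
    also have "\<dots> = ennreal (\<bar>?J x\<bar> * f (g x))"
      unfolding US by (auto simp: R_def indicator_def)
    finally show "(\<Sum>i. ennreal (\<bar>?J x\<bar> * f (g x)) * indicator (S i) x) = ennreal (\<bar>?J x\<bar> * f (g x))" .
  qed
  finally show ?thesis by (simp add: nn_integral_completion)
qed

section \<open>Measurability of the number of zeros\<close>

text \<open>On a compact set a continuous modulus attains its minimum, so a zero exists exactly when
  the values on a countable dense subset come arbitrarily close to 0. This makes the uncountable
  quantifier countable.\<close>

lemma sets_ex_zero_compact:
  fixes H :: "'a \<Rightarrow> 'b::euclidean_space \<Rightarrow> 'c::{real_normed_vector, second_countable_topology}"
  assumes [measurable]: "\<And>z. (\<lambda>a. H a z) \<in> borel_measurable M"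
    and cont: "\<And>a. a \<in> space M \<Longrightarrow> continuous_on UNIV (H a)"
    and K: "compact K"
  shows "{a \<in> space M. \<exists>z\<in>K. H a z = 0} \<in> sets M"
proof -
  obtain T where T: "countable T" "T \<subseteq> K" "K \<subseteq> closure T"
    by (rule separable)
  have "(\<exists>z\<in>K. H a z = 0) \<longleftrightarrow> (\<forall>j::nat. \<exists>z\<in>T. norm (H a z) < 1 / (real j + 1))" if a: "a \<in> space M" for a
  proof
    assume "\<exists>z\<in>K. H a z = 0"
    then obtain z where z: "z \<in> K" "H a z = 0" by blast
    show "\<forall>j::nat. \<exists>z\<in>T. norm (H a z) < 1 / (real j + 1)"
    proof
      fix j :: nat
      have "isCont (H a) z"
        using cont[OF a] by (simp add: continuous_on_eq_continuous_at)
      then obtain d where d: "d > 0" "\<And>y. dist y z < d \<Longrightarrow> dist (H a y) (H a z) < 1 / (real j + 1)"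
        unfolding continuous_at_eps_delta by (metis divide_pos_pos of_nat_0_le_iff add_nonneg_pos zero_less_one)
      obtain y where "y \<in> T" "dist y z < d"
        using T(3) z(1) d(1) closure_approachable[of z T] by blast
      then show "\<exists>z\<in>T. norm (H a z) < 1 / (real j + 1)"
        using d(2)[of y] z(2) by auto
    qed
  next
    assume *: "\<forall>j::nat. \<exists>z\<in>T. norm (H a z) < 1 / (real j + 1)"
    then have "K \<noteq> {}" using T(2) by auto
    moreover have "continuous_on K (\<lambda>z. norm (H a z))"
      using cont[OF a] by (intro continuous_intros) (rule continuous_on_subset, auto)
    ultimately obtain z where z: "z \<in> K" "\<And>y. y \<in> K \<Longrightarrow> norm (H a z) \<le> norm (H a y)"
      using continuous_attains_inf[OF K] by blast
    have "norm (H a z) \<le> 0"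
    proof (rule ccontr)
      assume "\<not> norm (H a z) \<le> 0"
      then obtain j :: nat where "1 / (real j + 1) < norm (H a z)"
        using reals_Archimedean[of "norm (H a z)"] by (auto simp: inverse_eq_divide add.commute)
      moreover obtain y where "y \<in> T" "norm (H a y) < 1 / (real j + 1)" using * by blast
      ultimately show False using z(2)[of y] T(2) by auto
    qed
    then show "\<exists>z\<in>K. H a z = 0" using z(1) by auto
  qed
  then have eq: "{a \<in> space M. \<exists>z\<in>K. H a z = 0} =
      (\<Inter>j::nat. \<Union>z\<in>T. {a \<in> space M. norm (H a z) < 1 / (real j + 1)}) \<inter> space M"
    by auto
  have "(\<Union>z\<in>T. {a \<in> space M. norm (H a z) < 1 / (real j + 1)}) \<in> sets M" for j :: nat
    using T(1) by (intro sets.countable_UN'') measurable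
  then show ?thesis
    unfolding eq by (intro sets.Int sets.countable_INT) auto
qed

text \<open>The count is the supremum, over the countably many finite families of disjoint balls
  with centres in \<open>D\<close> and a common rational radius, of the number of balls containing a
  zero. Disjointness keeps each sum below the count; small balls around finitely many zeros reach
  it.\<close>

lemma borel_measurable_count_zeros:
  fixes H :: "'a \<Rightarrow> 'b::euclidean_space \<Rightarrow> 'c::{real_normed_vector, second_countable_topology}"
  assumes meas: "\<And>z. (\<lambda>a. H a z) \<in> borel_measurable M"
    and cont: "\<And>a. a \<in> space M \<Longrightarrow> continuous_on UNIV (H a)"
  shows "(\<lambda>a. emeasure (count_space UNIV) {z. H a z = 0}) \<in> borel_measurable M"
proof -
  obtain D :: "'b set" where D: "countable D" "\<And>X. open X \<Longrightarrow> X \<noteq> {} \<Longrightarrow> \<exists>d\<in>D. d \<in> X"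
    using countable_dense_setE by blast
  define I where "I = {(Q, r). finite Q \<and> Q \<subseteq> D \<and> r \<in> (\<rat>::real set) \<and> disjoint_family_on (\<lambda>q. cball q r) Q}"
  have I: "countable I"
  proof (rule countable_subset)
    show "I \<subseteq> {Q. finite Q \<and> Q \<subseteq> D} \<times> \<rat>" by (auto simp: I_def)
    show "countable ({Q. finite Q \<and> Q \<subseteq> D} \<times> (\<rat>::real set))"
      using countable_Collect_finite_subset[OF D(1)] countable_rat by blast
  qed
  define hit where "hit q r = {a \<in> space M. \<exists>z\<in>cball q r. H a z = 0}" for q :: 'b and r
  have [measurable]: "hit q r \<in> sets M" for q r
    unfolding hit_def by (rule sets_ex_zero_compact[OF meas cont compact_cball])
  define S where "S a = (SUP (Q, r)\<in>I. \<Sum>q\<in>Q. indicator (hit q r) a :: ennreal)" for a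
  have "emeasure (count_space UNIV) {z. H a z = 0} = S a" if a: "a \<in> space M" for a
  proof (rule antisym)
    let ?Z = "{z. H a z = 0}"
    have fin: "of_nat (card Z) \<le> S a" if Z: "finite Z" "Z \<subseteq> ?Z" for Z
    proof -
      obtain e where e: "e > 0" "\<And>x y. x \<in> Z \<Longrightarrow> y \<in> Z \<Longrightarrow> x \<noteq> y \<Longrightarrow> e \<le> dist x y"
      proof -
        let ?P = "{(x, y). x \<in> Z \<and> y \<in> Z \<and> x \<noteq> y}"
        \<comment> \<open>The extra 1 gives a positive separation even when \<open>Z\<close> has at
          most one point.\<close>
        let ?E = "insert 1 ((\<lambda>(x, y). dist x y) ` ?P)"
        have "?P \<subseteq> Z \<times> Z" by auto
        then have "finite ?P" using Z(1) finite_subset by blast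
        then have fE: "finite ?E" by blast
        have "Min ?E > 0" using fE by (subst Min_gr_iff) auto
        moreover have "Min ?E \<le> dist x y" if "x \<in> Z" "y \<in> Z" "x \<noteq> y" for x y
          using that by (intro Min_le[OF fE]) auto
        ultimately show ?thesis using that by blast
      qed
      \<comment> \<open>A centre lies within \<open>e/5\<close> of its zero, so
        \<open>r > e/5\<close> makes the ball contain it; \<open>r < e/4\<close> makes the balls
        disjoint, because \<open>2e/5 + 2e/4 < e\<close>.\<close>
      obtain r where r: "r \<in> \<rat>" "e / 5 < r" "r < e / 4"
        using Rats_dense_in_real[of "e / 5" "e / 4"] e(1) by auto
      have "\<exists>q\<in>D. dist z q < e / 5" for z
        using D(2)[of "ball z (e / 5)"] e(1) by auto
      then obtain q where q: "\<And>z. q z \<in> D" "\<And>z. dist z (q z) < e / 5" by metis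
      have dis: "cball (q x) r \<inter> cball (q y) r = {}" if "x \<in> Z" "y \<in> Z" "x \<noteq> y" for x y
      proof (rule ccontr)
        assume "cball (q x) r \<inter> cball (q y) r \<noteq> {}"
        then obtain w where "dist (q x) w \<le> r" "dist (q y) w \<le> r" by auto
        moreover have "dist x y \<le> dist x (q x) + dist (q x) w + dist (q y) w + dist y (q y)"
          by metric
        ultimately show False
          using e(2)[OF that] q(2)[of x] q(2)[of y] r(3) e(1) by linarith
      qed
      have rpos: "r > 0" using r e(1) by linarith
      have inj: "inj_on q Z"
        using dis rpos by (fastforce simp: inj_on_def)
      have "(q ` Z, r) \<in> I"
        using Z(1) q(1) r(1) dis by (auto simp: I_def disjoint_family_on_def)
      moreover have "(\<Sum>p\<in>q ` Z. indicator (hit p r) a :: ennreal) = of_nat (card Z)"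
      proof -
        have "a \<in> hit (q z) r" if "z \<in> Z" for z
          using that Z(2) a q(2)[of z] r by (auto simp: hit_def dist_commute intro!: bexI[of _ z])
        then show ?thesis by (simp add: sum.reindex[OF inj])
      qed
      ultimately show ?thesis
        unfolding S_def by (metis (mono_tags, lifting) SUP_upper case_prod_conv)
    qed
    show "emeasure (count_space UNIV) ?Z \<le> S a"
    proof (cases "finite ?Z")
      case True
      then show ?thesis using fin[of ?Z] by (simp add: emeasure_count_space_finite)
    next
      case False
      have "of_nat n \<le> S a" for n
      proof -
        obtain Z where "finite Z" "card Z = n" "Z \<subseteq> ?Z"
          using infinite_arbitrarily_large[OF False] by blast
        then show ?thesis using fin by blast
      qed
      then have "S a = top"
        by (metis ennreal_SUP_of_nat_eq_top SUP_least top.extremum_unique)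
      then show ?thesis by simp
    qed
    show "S a \<le> emeasure (count_space UNIV) ?Z"
      unfolding S_def
    proof (rule SUP_least, clarify)
      fix Q r assume "(Q, r) \<in> I"
      then have Q: "finite Q" "disjoint_family_on (\<lambda>q. cball q r) Q" by (auto simp: I_def)
      define Q' where "Q' = {q\<in>Q. a \<in> hit q r}"
      have Q': "finite Q'" using Q by (simp add: Q'_def)
      have "\<exists>z. z \<in> cball q r \<and> H a z = 0" if "q \<in> Q'" for q
        using that by (auto simp: Q'_def hit_def)
      then obtain z where z: "\<And>q. q \<in> Q' \<Longrightarrow> z q \<in> cball q r \<and> H a (z q) = 0" by metis
      have "inj_on z Q'"
      proof (rule inj_onI, rule ccontr)
        fix x y assume xy: "x \<in> Q'" "y \<in> Q'" "z x = z y" "x \<noteq> y"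
        then have "cball x r \<inter> cball y r = {}"
          using Q(2) by (auto simp: disjoint_family_on_def Q'_def)
        with xy z[of x] z[of y] show False by auto
      qed
      then have "card Q' = card (z ` Q')" by (simp add: card_image)
      have "(\<Sum>q\<in>Q. indicator (hit q r) a :: ennreal) = (\<Sum>q\<in>Q'. 1)"
        using Q(1) unfolding Q'_def by (intro sum.mono_neutral_cong_right) auto
      also have "\<dots> = of_nat (card (z ` Q'))"
        using \<open>card Q' = _\<close> by simp
      also have "\<dots> = emeasure (count_space UNIV) (z ` Q')"
        using Q' by (simp add: emeasure_count_space_finite)
      also have "\<dots> \<le> emeasure (count_space UNIV) ?Z"
        using z by (intro emeasure_mono) auto
      finally show "(\<Sum>q\<in>Q. indicator (hit q r) a) \<le> emeasure (count_space UNIV) ?Z" .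
    qed
  qed
  moreover have "S \<in> borel_measurable M"
    unfolding S_def using I by (intro borel_measurable_SUP) (auto intro!: borel_measurable_sum)
  ultimately show ?thesis
    by (subst measurable_cong[of _ _ S]) auto
qed

section \<open>The area formula in the complex plane\<close>

definition vec_of_complex :: "complex \<Rightarrow> real^2" where
  "vec_of_complex z = (\<chi> i. if i = 1 then Re z else Im z)"

definition complex_of_vec :: "real^2 \<Rightarrow> complex" where
  "complex_of_vec x = Complex (x $ 1) (x $ 2)"

lemma vec_of_complex_nth [simp]: "vec_of_complex z $ 1 = Re z" "vec_of_complex z $ 2 = Im z"
  by (simp_all add: vec_of_complex_def)

lemma complex_of_vec_inverse [simp]:
  "complex_of_vec (vec_of_complex z) = z" "vec_of_complex (complex_of_vec x) = x"
  by (simp_all add: complex_of_vec_def vec_eq_iff forall_2)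

lemma norm_complex_of_vec [simp]: "norm (complex_of_vec x) = norm x"
  by (simp add: complex_of_vec_def norm_vec_def L2_set_def sum_2 cmod_def)

lemma norm_vec_of_complex [simp]: "norm (vec_of_complex z) = norm z"
  using norm_complex_of_vec[of "vec_of_complex z"] by simp

lemma bounded_linear_complex_of_vec: "bounded_linear complex_of_vec"
proof (rule bounded_linear_intro[where K = 1])
  show "norm (complex_of_vec x) \<le> norm x * 1" for x
    by simp
qed (auto simp: complex_of_vec_def complex_eq_iff)

lemma bounded_linear_vec_of_complex: "bounded_linear vec_of_complex"
  by (rule bounded_linear_intro[where K = 1]) (auto simp: vec_eq_iff forall_2)

lemma continuous_complex_of_vec [continuous_intros]: "continuous_on A complex_of_vec"
  by (intro linear_continuous_on bounded_linear_complex_of_vec)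

lemma complex_of_vec_measurable [measurable]: "complex_of_vec \<in> borel_measurable borel"
  by (intro borel_measurable_continuous_onI continuous_complex_of_vec)

lemma Basis_real2: "(Basis :: (real^2) set) = {axis 1 1, axis 2 1}"
  by (auto simp: Basis_vec_def UNIV_2)

lemma lborel_complex_eq_distr_vec: "(lborel :: complex measure) = distr lborel borel complex_of_vec"
proof (rule lborel_eqI)
  fix l u :: complex
  assume lu: "\<And>b. b \<in> Basis \<Longrightarrow> l \<bullet> b \<le> u \<bullet> b"
  then have le: "Re l \<le> Re u" "Im l \<le> Im u"
    using lu[of 1] lu[of \<i>] by (auto simp: Basis_complex_def inner_complex_def)
  have "emeasure (distr lborel borel complex_of_vec) (box l u) = emeasure lborel (complex_of_vec -` box l u)"
    by (subst emeasure_distr) auto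
  also have "complex_of_vec -` box l u = box (vec_of_complex l) (vec_of_complex u)"
    by (auto simp: box_def Basis_complex_def inner_complex_def Basis_real2 inner_axis complex_of_vec_def)
  also have "emeasure lborel \<dots> = ennreal (\<Prod>b\<in>Basis. (vec_of_complex u - vec_of_complex l) \<bullet> b)"
    using le by (intro emeasure_lborel_box) (auto simp: Basis_real2 inner_axis)
  also have "\<dots> = ennreal (\<Prod>b\<in>Basis. (u - l) \<bullet> b)"
    by (simp add: Basis_complex_def inner_complex_def Basis_real2 inner_axis axis_eq_axis)
  finally show "emeasure (distr lborel borel complex_of_vec) (box l u) = ennreal (\<Prod>b\<in>Basis. (u - l) \<bullet> b)" .
qed simp

text \<open>\<open>u\<close> and \<open>v\<close> are the two Wirtinger derivatives of
  \<open>G\<close>; the real Jacobian determinant of \<open>h \<mapsto> u h + v cnj h\<close> is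
  \<open>|u|^2 - |v|^2\<close>.\<close>

lemma area_formula_complex:
  fixes G u v :: "complex \<Rightarrow> complex" and f :: "complex \<Rightarrow> real"
  assumes der: "\<And>z. (G has_derivative (\<lambda>h. u z * h + v z * cnj h)) (at z)"
    and u: "continuous_on UNIV u" and v: "continuous_on UNIV v"
    and f: "integrable lborel f" "\<And>w. 0 \<le> f w"
  shows "(\<integral>\<^sup>+w. ennreal (f w) * emeasure (count_space UNIV) {z. G z = w} \<partial>lborel) =
      (\<integral>\<^sup>+z. ennreal (\<bar>(norm (u z))\<^sup>2 - (norm (v z))\<^sup>2\<bar> * f (G z)) \<partial>lborel)"
proof -
  let ?\<phi> = complex_of_vec and ?\<psi> = vec_of_complex
  have contG: "continuous_on UNIV G"
    using der has_derivative_continuous continuous_at_imp_continuous_on by blast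
  have [measurable]: "G \<in> borel_measurable borel" "u \<in> borel_measurable borel" "v \<in> borel_measurable borel"
    "f \<in> borel_measurable borel"
    using contG u v f(1) by (auto intro: borel_measurable_continuous_onI)
  have [measurable]: "(\<lambda>w. emeasure (count_space UNIV) {z. G z = w}) \<in> borel_measurable borel"
    using borel_measurable_count_zeros[of "\<lambda>w z. G z - w" borel] contG
    by (simp add: continuous_intros)
  define g where "g x = ?\<psi> (G (?\<phi> x))" for x
  define g' where "g' x h = ?\<psi> (u (?\<phi> x) * ?\<phi> h + v (?\<phi> x) * cnj (?\<phi> h))" for x h
  have der': "(g has_derivative g' x) (at x)" for x
  proof -
    have "((\<lambda>x. G (?\<phi> x)) has_derivative (\<lambda>h. u (?\<phi> x) * ?\<phi> h + v (?\<phi> x) * cnj (?\<phi> h))) (at x)"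
      by (rule has_derivative_compose[OF bounded_linear_imp_has_derivative[OF bounded_linear_complex_of_vec] der])
    then show ?thesis
      unfolding g_def g'_def by (rule bounded_linear.has_derivative[OF bounded_linear_vec_of_complex])
  qed
  have det: "det (matrix (g' x)) = (norm (u (?\<phi> x)))\<^sup>2 - (norm (v (?\<phi> x)))\<^sup>2" for x
  proof -
    have "?\<phi> (axis 1 1) = 1" "?\<phi> (axis 2 1) = \<i>"
      by (simp_all add: complex_of_vec_def complex_eq_iff axis_def)
    then show ?thesis
      unfolding cmod_power2 by (simp add: det_2 matrix_def g'_def power2_eq_square algebra_simps)
  qed
  have cont: "\<exists>d>0. \<forall>y. dist x y < d \<longrightarrow> onorm (\<lambda>h. g' y h - g' x h) < e" if e: "e > 0" for x e
  proof -
    define k where "k y = norm (u (?\<phi> y) - u (?\<phi> x)) + norm (v (?\<phi> y) - v (?\<phi> x))" for y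
    have "continuous_on UNIV k"
      unfolding k_def
      by (intro continuous_intros continuous_on_compose2[OF u] continuous_on_compose2[OF v]) auto
    then have "isCont k x" by (simp add: continuous_on_eq_continuous_at)
    then obtain d where d: "d > 0" "\<And>y. dist y x < d \<Longrightarrow> dist (k y) (k x) < e"
      unfolding continuous_at_eps_delta using e by blast
    have "onorm (\<lambda>h. g' y h - g' x h) \<le> k y" for y
    proof (rule onorm_le)
      fix h
      interpret bounded_linear ?\<psi> by (rule bounded_linear_vec_of_complex)
      have "g' y h - g' x h = ?\<psi> ((u (?\<phi> y) - u (?\<phi> x)) * ?\<phi> h + (v (?\<phi> y) - v (?\<phi> x)) * cnj (?\<phi> h))"
        unfolding g'_def diff[symmetric] by (simp add: algebra_simps)
      also have "norm \<dots> \<le> k y * norm h"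
        using norm_triangle_ineq[of "(u (?\<phi> y) - u (?\<phi> x)) * ?\<phi> h" "(v (?\<phi> y) - v (?\<phi> x)) * cnj (?\<phi> h)"]
        by (simp add: k_def norm_mult distrib_right)
      finally show "norm (g' y h - g' x h) \<le> k y * norm h" .
    qed
    moreover have "k y < e" if "dist x y < d" for y
      using d(2)[of y] that by (simp add: dist_commute k_def)
    ultimately show ?thesis using d(1) le_less_trans by blast
  qed
  have f': "integrable lborel (\<lambda>x. f (?\<phi> x))"
    using f(1) by (subst (asm) lborel_complex_eq_distr_vec) (simp add: integrable_distr_eq)
  have "(\<integral>\<^sup>+w. ennreal (f w) * emeasure (count_space UNIV) {z. G z = w} \<partial>lborel) =
      (\<integral>\<^sup>+x. ennreal (f (?\<phi> x)) * emeasure (count_space UNIV) {z. G z = ?\<phi> x} \<partial>lborel)"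
    by (subst lborel_complex_eq_distr_vec, subst nn_integral_distr) auto
  also have "\<dots> = (\<integral>\<^sup>+x. ennreal (f (?\<phi> x)) * emeasure (count_space UNIV) (g -` {x}) \<partial>lborel)"
  proof -
    have "emeasure (count_space UNIV) {z. G z = ?\<phi> x} = emeasure (count_space UNIV) (g -` {x})" for x
    proof -
      have "bij_betw ?\<phi> (g -` {x}) {z. G z = ?\<phi> x}"
      proof (rule bij_betwI[where g = ?\<psi>])
        have "?\<phi> (g y) = G (?\<phi> y)" for y by (simp add: g_def)
        then show "?\<phi> \<in> g -` {x} \<rightarrow> {z. G z = ?\<phi> x}" by fastforce
        show "?\<psi> \<in> {z. G z = ?\<phi> x} \<rightarrow> g -` {x}" by (auto simp: g_def)
      qed auto
      then show ?thesis
        by (simp add: emeasure_count_space bij_betw_same_card bij_betw_finite)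
    qed
    then show ?thesis by simp
  qed
  also have "\<dots> = (\<integral>\<^sup>+x. ennreal (\<bar>det (matrix (g' x))\<bar> * f (?\<phi> (g x))) \<partial>lborel)"
    by (rule area_formula[OF der' cont f']) (use f in auto)
  also have "\<dots> = (\<integral>\<^sup>+x. ennreal (\<bar>(norm (u (?\<phi> x)))\<^sup>2 - (norm (v (?\<phi> x)))\<^sup>2\<bar> * f (G (?\<phi> x))) \<partial>lborel)"
    unfolding det by (simp add: g_def)
  also have "\<dots> = (\<integral>\<^sup>+z. ennreal (\<bar>(norm (u z))\<^sup>2 - (norm (v z))\<^sup>2\<bar> * f (G z)) \<partial>lborel)"
    by (subst lborel_complex_eq_distr_vec, subst nn_integral_distr) auto
  finally show ?thesis .
qed

section \<open>The Kac--Rice formula\<close>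

lemma num_zeros_eq_count: "num_zeros H UNIV = emeasure (count_space UNIV) {z. H z = 0}"
  by (simp add: num_zeros_def emeasure_count_space ennreal_of_nat_eq_real_of_nat)

lemma integrable_gauss_density: "integrable lborel gauss_density"
proof (rule integrableI_nonneg)
  have "(\<integral>\<^sup>+z. ennreal (gauss_density z) \<partial>lborel) = 1"
    using nn_integral_cgauss[of "\<lambda>_. 1"] by simp
  then show "(\<integral>\<^sup>+z. ennreal (gauss_density z) \<partial>lborel) < \<infinity>" by simp
qed auto

lemma gauss_density_minus [simp]: "gauss_density (- z) = gauss_density z"
  by (simp add: gauss_density_def)

text \<open>\<open>H(z) = a - G(z)\<close>, so zeros are preimages of \<open>a\<close>; the sign of
  \<open>G\<close> disappears because the density is even. The terms with \<open>k = 0\<close> in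
  the derivative sum of \<open>B\<close> vanish through the factor \<open>of_nat k\<close>, whatever
  the truncated exponent.\<close>

lemma nn_integral_num_zeros_constant_coeff:
  "(\<integral>\<^sup>+a. num_zeros (harm_poly n m (A(0 := a), B)) UNIV \<partial>cgauss) =
    (\<integral>\<^sup>+z. ennreal (\<bar>(norm (\<Sum>k=1..n. of_nat k * A k * z ^ (k - 1)))\<^sup>2 - (norm (\<Sum>k\<le>m. of_nat k * B k * z ^ (k - 1)))\<^sup>2\<bar> *
      gauss_density ((\<Sum>k=1..n. A k * z ^ k) + cnj (\<Sum>k\<le>m. B k * z ^ k))) \<partial>lborel)"
proof -
  define P where "P z = (\<Sum>k=1..n. A k * z ^ k)" for z
  define P' where "P' z = (\<Sum>k=1..n. of_nat k * A k * z ^ (k - 1))" for z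
  define Q where "Q z = (\<Sum>k\<le>m. B k * z ^ k)" for z
  define Q' where "Q' z = (\<Sum>k\<le>m. of_nat k * B k * z ^ (k - 1))" for z
  define G where "G z = - (P z + cnj (Q z))" for z
  have "(P has_field_derivative P' z) (at z)" for z
    unfolding P_def P'_def by (auto intro!: derivative_eq_intros sum.cong)
  then have dP: "(P has_derivative (\<lambda>h. P' z * h)) (at z)" for z
    by (simp add: has_field_derivative_def)
  have "(Q has_field_derivative Q' z) (at z)" for z
    unfolding Q_def Q'_def by (auto intro!: derivative_eq_intros sum.cong)
  then have dQ: "(Q has_derivative (\<lambda>h. Q' z * h)) (at z)" for z
    by (simp add: has_field_derivative_def)
  have der: "(G has_derivative (\<lambda>h. - P' z * h + - cnj (Q' z) * cnj h)) (at z)" for z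
    unfolding G_def
    by (rule derivative_eq_intros dP bounded_linear.has_derivative[OF bounded_linear_cnj dQ] refl)+ simp
  have H: "harm_poly n m (A(0 := a), B) z = 0 \<longleftrightarrow> G z = a" for a z
  proof -
    have "(\<Sum>k\<le>n. (A(0 := a)) k * z ^ k) = a + P z"
    proof -
      have "{..n} = insert 0 {1..n}" by auto
      then have "(\<Sum>k\<le>n. (A(0 := a)) k * z ^ k) = a + (\<Sum>k=1..n. (A(0 := a)) k * z ^ k)" by simp
      also have "(\<Sum>k=1..n. (A(0 := a)) k * z ^ k) = P z"
        unfolding P_def by (intro sum.cong) auto
      finally show ?thesis .
    qed
    then have "harm_poly n m (A(0 := a), B) z = a - G z"
      by (simp add: harm_poly_def G_def Q_def)
    then show ?thesis by auto
  qed
  have contG: "continuous_on UNIV G"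
    using der has_derivative_continuous continuous_at_imp_continuous_on by blast
  have [measurable]: "(\<lambda>w. emeasure (count_space UNIV) {z. G z = w}) \<in> borel_measurable borel"
    using borel_measurable_count_zeros[of "\<lambda>w z. G z - w" borel] contG
    by (simp add: continuous_intros)
  have "(\<integral>\<^sup>+a. num_zeros (harm_poly n m (A(0 := a), B)) UNIV \<partial>cgauss) =
      (\<integral>\<^sup>+w. ennreal (gauss_density w) * emeasure (count_space UNIV) {z. G z = w} \<partial>lborel)"
    by (simp add: num_zeros_eq_count H nn_integral_cgauss)
  also have "\<dots> = (\<integral>\<^sup>+z. ennreal (\<bar>(norm (- P' z))\<^sup>2 - (norm (- cnj (Q' z)))\<^sup>2\<bar> * gauss_density (G z)) \<partial>lborel)"
    by (rule area_formula_complex[OF der])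
       (auto simp: P'_def Q'_def integrable_gauss_density intro!: continuous_intros)
  also have "\<dots> = (\<integral>\<^sup>+z. ennreal (\<bar>(norm (P' z))\<^sup>2 - (norm (Q' z))\<^sup>2\<bar> * gauss_density (P z + cnj (Q z))) \<partial>lborel)"
    unfolding G_def gauss_density_minus by simp
  finally show ?thesis by (simp add: P_def P'_def Q_def Q'_def)
qed

section \<open>Moments of the exponent under the weights \<open>t^k\<close>\<close>

text \<open>At \<open>t = |z|^2\<close> the cases \<open>j = 0, 1, 2\<close> are the variance of
  \<open>p(z)\<close>, its covariance with \<open>z p'(z)\<close>, and the variance of
  \<open>z p'(z)\<close>. As \<open>0 ^ 0 = 1\<close>, the term \<open>k = 0\<close> counts for
  \<open>j = 0\<close> only.\<close>

definition kac_moment :: "nat \<Rightarrow> nat \<Rightarrow> real \<Rightarrow> real" where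
  "kac_moment j n t = (\<Sum>k\<le>n. real k ^ j * t ^ k)"

lemma kac_moment_ge_1: "0 \<le> t \<Longrightarrow> 1 \<le> kac_moment 0 n t"
  unfolding kac_moment_def using member_le_sum[of 0 "{..n}" "\<lambda>k. t ^ k"] by simp

lemma kac_moment_nonneg: "0 \<le> t \<Longrightarrow> 0 \<le> kac_moment j n t"
  unfolding kac_moment_def by (intro sum_nonneg) auto

lemma kac_moment_Suc: "kac_moment (Suc j) n t = (\<Sum>k=1..n. real k ^ Suc j * t ^ k)"
proof -
  have "{..n} = insert 0 {1..n}" by auto
  then show ?thesis by (simp add: kac_moment_def)
qed

lemma kac_moment_0: "kac_moment 0 n t = 1 + (\<Sum>k=1..n. t ^ k)"
proof -
  have "{..n} = insert 0 {1..n}" by auto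
  then show ?thesis by (simp add: kac_moment_def)
qed

text \<open>The improvement by 1 is available since \<open>k = 0\<close> contributes to the zeroth
  moment only. It is the positivity of the covariance matrix that remains after \<open>A_0\<close>
  is removed.\<close>

lemma kac_moment_Cauchy_Schwarz:
  assumes "0 \<le> t"
  shows "(kac_moment 1 n t)\<^sup>2 \<le> (kac_moment 0 n t - 1) * kac_moment 2 n t"
proof -
  have e: "(sqrt t ^ k)\<^sup>2 = t ^ k" "sqrt t ^ k * (real k * sqrt t ^ k) = real k * t ^ k"
    "(real k * sqrt t ^ k)\<^sup>2 = real k ^ 2 * t ^ k" for k
  proof -
    have "sqrt t ^ k * sqrt t ^ k = t ^ k"
      using assms by (simp add: power_mult_distrib[symmetric])
    then show "(sqrt t ^ k)\<^sup>2 = t ^ k" "sqrt t ^ k * (real k * sqrt t ^ k) = real k * t ^ k"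
      "(real k * sqrt t ^ k)\<^sup>2 = real k ^ 2 * t ^ k"
      by (simp_all add: power2_eq_square mult_ac)
  qed
  have "(\<Sum>k=1..n. sqrt t ^ k * (real k * sqrt t ^ k))\<^sup>2 \<le>
     (\<Sum>k=1..n. (sqrt t ^ k)\<^sup>2) * (\<Sum>k=1..n. (real k * sqrt t ^ k)\<^sup>2)"
    by (rule Cauchy_Schwarz_ineq_sum)
  then have "(\<Sum>k=1..n. real k * t ^ k)\<^sup>2 \<le> (\<Sum>k=1..n. t ^ k) * (\<Sum>k=1..n. real k ^ 2 * t ^ k)"
    unfolding e .
  then show ?thesis
    using kac_moment_Suc[of 0 n t] kac_moment_Suc[of 1 n t]
    by (simp add: kac_moment_0 numeral_2_eq_2)
qed

text \<open>Multiplying the derivatives by \<open>z\<close> gives value and derivative the same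
  phases \<open>u k\<close>, which unit invariance removes, leaving the real coefficients
  \<open>r^k\<close> and \<open>k r^k\<close>. The factor \<open>1 / t\<close> undoes this
  multiplication.\<close>

lemma kac_rice_density:
  assumes z: "z \<noteq> (0::complex)"
  defines "t \<equiv> (norm z)\<^sup>2"
  shows "(\<integral>\<^sup>+B. \<integral>\<^sup>+A. ennreal (\<bar>(norm (\<Sum>k=1..n. of_nat k * A k * z ^ (k - 1)))\<^sup>2 - (norm (\<Sum>k\<le>n. of_nat k * B k * z ^ (k - 1)))\<^sup>2\<bar> *
      gauss_density ((\<Sum>k=1..n. A k * z ^ k) + cnj (\<Sum>k\<le>n. B k * z ^ k)))
        \<partial>Pi\<^sub>M {1..n} (\<lambda>_. cgauss) \<partial>Pi\<^sub>M {..n} (\<lambda>_. cgauss)) =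
    ennreal (sqrt (kac_moment 2 n t * (kac_moment 2 n t - (kac_moment 1 n t)\<^sup>2 / kac_moment 0 n t)) / (2 * pi * kac_moment 0 n t * t))"
proof -
  define r where "r = norm z"
  have r: "r > 0" "r\<^sup>2 = t" using z by (simp_all add: r_def t_def)
  have t: "t > 0" using r by auto
  define u where "u k = (z / r) ^ k" for k :: nat
  have u: "norm (u k) = 1" for k
    using r by (simp add: u_def norm_power norm_divide r_def)
  have zk: "z ^ k = complex_of_real (r ^ k) * u k" for k
    using r(1) by (simp add: u_def power_divide)
  have zk1: "z * (of_nat k * a * z ^ (k - 1)) = complex_of_real (real k * r ^ k) * (u k * a)" for k a
  proof (cases k)
    case (Suc j)
    then have "z * (of_nat k * a * z ^ (k - 1)) = of_nat k * a * z ^ k" by simp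
    then show ?thesis by (simp add: zk mult_ac)
  qed simp
  let ?a = "\<lambda>k::nat. r ^ k" and ?b = "\<lambda>k::nat. real k * r ^ k"
  have int: "ennreal (\<bar>(norm (\<Sum>k=1..n. of_nat k * A k * z ^ (k - 1)))\<^sup>2 - (norm (\<Sum>k\<le>n. of_nat k * B k * z ^ (k - 1)))\<^sup>2\<bar> *
      gauss_density ((\<Sum>k=1..n. A k * z ^ k) + cnj (\<Sum>k\<le>n. B k * z ^ k))) =
    ennreal (1 / t) * (ennreal (gauss_density ((\<Sum>k=1..n. complex_of_real (?a k) * (u k * A k)) + cnj (\<Sum>k\<le>n. complex_of_real (?a k) * (u k * B k)))) *
       ennreal \<bar>(norm (\<Sum>k=1..n. complex_of_real (?b k) * (u k * A k)))\<^sup>2 - (norm (\<Sum>k\<le>n. complex_of_real (?b k) * (u k * B k)))\<^sup>2\<bar>)" for A B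
  proof -
    have s1: "(\<Sum>k\<in>I. complex_of_real (?b k) * (u k * X k)) = z * (\<Sum>k\<in>I. of_nat k * X k * z ^ (k - 1))" for I X
      unfolding sum_distrib_left by (simp only: zk1)
    have s2: "(\<Sum>k\<in>I. complex_of_real (?a k) * (u k * X k)) = (\<Sum>k\<in>I. X k * z ^ k)" for I X
      by (simp add: zk mult_ac)
    have s3: "\<bar>(norm (z * x))\<^sup>2 - (norm (z * y))\<^sup>2\<bar> = t * \<bar>(norm x)\<^sup>2 - (norm y)\<^sup>2\<bar>" for x y
    proof -
      have "(norm (z * x))\<^sup>2 - (norm (z * y))\<^sup>2 = t * ((norm x)\<^sup>2 - (norm y)\<^sup>2)"
        by (simp add: norm_mult power_mult_distrib t_def algebra_simps)
      then show ?thesis using t by (simp add: abs_mult)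
    qed
    show ?thesis
      unfolding s1 s2 s3 using t by (simp add: ennreal_mult[symmetric] mult_ac)
  qed
  have e: "(?a k)\<^sup>2 = t ^ k" "?a k * ?b k = real k * t ^ k" "(?b k)\<^sup>2 = real k ^ 2 * t ^ k" for k
  proof -
    have "r ^ k * r ^ k = t ^ k"
      by (simp add: r(2)[symmetric] power_mult_distrib[symmetric] power2_eq_square)
    then show "(?a k)\<^sup>2 = t ^ k" "?a k * ?b k = real k * t ^ k" "(?b k)\<^sup>2 = real k ^ 2 * t ^ k"
      by (simp_all add: power2_eq_square mult_ac)
  qed
  have sumA: "(\<Sum>k=1..n. (?a k)\<^sup>2) = kac_moment 0 n t - 1" "(\<Sum>k=1..n. ?a k * ?b k) = kac_moment 1 n t"
      "(\<Sum>k=1..n. (?b k)\<^sup>2) = kac_moment 2 n t"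
    using kac_moment_Suc[of 0 n t] kac_moment_Suc[of 1 n t]
    unfolding e by (simp_all add: kac_moment_0 numeral_2_eq_2)
  have sumB: "(\<Sum>k\<le>n. (?a k)\<^sup>2) = kac_moment 0 n t" "(\<Sum>k\<le>n. ?a k * ?b k) = kac_moment 1 n t"
      "(\<Sum>k\<le>n. (?b k)\<^sup>2) = kac_moment 2 n t"
    unfolding e by (simp_all add: kac_moment_def)
  define K where "K = (\<lambda>(p'::complex, q'::complex). bigauss (kac_moment 0 n t - 1) (kac_moment 1 n t) (kac_moment 2 n t)
      (\<lambda>(p, q). ennreal (gauss_density (p + cnj p')) * ennreal \<bar>(norm q)\<^sup>2 - (norm q')\<^sup>2\<bar>))"
  have [measurable]: "K \<in> borel_measurable (borel \<Otimes>\<^sub>M borel)"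
    unfolding K_def by measurable
  have "(\<integral>\<^sup>+B. \<integral>\<^sup>+A. ennreal (\<bar>(norm (\<Sum>k=1..n. of_nat k * A k * z ^ (k - 1)))\<^sup>2 - (norm (\<Sum>k\<le>n. of_nat k * B k * z ^ (k - 1)))\<^sup>2\<bar> *
      gauss_density ((\<Sum>k=1..n. A k * z ^ k) + cnj (\<Sum>k\<le>n. B k * z ^ k)))
        \<partial>Pi\<^sub>M {1..n} (\<lambda>_. cgauss) \<partial>Pi\<^sub>M {..n} (\<lambda>_. cgauss)) =
     (\<integral>\<^sup>+B. ennreal (1 / t) * K (\<Sum>k\<le>n. complex_of_real (?a k) * (u k * B k), \<Sum>k\<le>n. complex_of_real (?b k) * (u k * B k)) \<partial>Pi\<^sub>M {..n} (\<lambda>_. cgauss))"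
  proof (rule nn_integral_cong)
    fix B :: "nat \<Rightarrow> complex"
    let ?p' = "\<Sum>k\<le>n. complex_of_real (?a k) * (u k * B k)" and ?q' = "\<Sum>k\<le>n. complex_of_real (?b k) * (u k * B k)"
    have "(\<integral>\<^sup>+A. ennreal (gauss_density ((\<Sum>k=1..n. complex_of_real (?a k) * (u k * A k)) + cnj ?p')) *
       ennreal \<bar>(norm (\<Sum>k=1..n. complex_of_real (?b k) * (u k * A k)))\<^sup>2 - (norm ?q')\<^sup>2\<bar> \<partial>Pi\<^sub>M {1..n} (\<lambda>_. cgauss)) = K (?p', ?q')"
      using nn_integral_PiM_cgauss_pair[of "{1..n}" u
          "\<lambda>(p, q). ennreal (gauss_density (p + cnj ?p')) * ennreal \<bar>(norm q)\<^sup>2 - (norm ?q')\<^sup>2\<bar>" ?a ?b, OF _ u]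
      unfolding sumA K_def by simp
    then show "(\<integral>\<^sup>+A. ennreal (\<bar>(norm (\<Sum>k=1..n. of_nat k * A k * z ^ (k - 1)))\<^sup>2 - (norm (\<Sum>k\<le>n. of_nat k * B k * z ^ (k - 1)))\<^sup>2\<bar> *
      gauss_density ((\<Sum>k=1..n. A k * z ^ k) + cnj (\<Sum>k\<le>n. B k * z ^ k)))
        \<partial>Pi\<^sub>M {1..n} (\<lambda>_. cgauss)) = ennreal (1 / t) * K (?p', ?q')"
      unfolding int by (subst nn_integral_cmult) simp_all
  qed
  also have "\<dots> = ennreal (1 / t) * (\<integral>\<^sup>+B. K (\<Sum>k\<le>n. complex_of_real (?a k) * (u k * B k), \<Sum>k\<le>n. complex_of_real (?b k) * (u k * B k)) \<partial>Pi\<^sub>M {..n} (\<lambda>_. cgauss))"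
    by (rule nn_integral_cmult) measurable
  also have "\<dots> = ennreal (1 / t) * bigauss (kac_moment 0 n t) (kac_moment 1 n t) (kac_moment 2 n t) K"
    using nn_integral_PiM_cgauss_pair[of "{..n}" u K ?a ?b, OF _ u] unfolding sumB by simp
  also have "\<dots> = ennreal (1 / t) * ennreal (sqrt (kac_moment 2 n t * (kac_moment 2 n t - (kac_moment 1 n t)\<^sup>2 / kac_moment 0 n t)) / (2 * pi * kac_moment 0 n t))"
    unfolding K_def using t
    by (subst bigauss_kac_rice_density) (auto simp: kac_moment_nonneg kac_moment_ge_1 kac_moment_Cauchy_Schwarz[unfolded One_nat_def])
  also have "\<dots> = ennreal (sqrt (kac_moment 2 n t * (kac_moment 2 n t - (kac_moment 1 n t)\<^sup>2 / kac_moment 0 n t)) / (2 * pi * kac_moment 0 n t * t))"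
    using t by (subst ennreal_mult'[symmetric]) (simp_all add: mult_ac)
  finally show ?thesis .
qed

lemma num_zeros_harm_poly_measurable [measurable]:
  "(\<lambda>AB. num_zeros (harm_poly n m AB) UNIV) \<in> borel_measurable (harm_kac n m)"
  unfolding num_zeros_eq_count
proof (rule borel_measurable_count_zeros)
  show "(\<lambda>AB. harm_poly n m AB z) \<in> borel_measurable (harm_kac n m)" for z
    unfolding harm_poly_def harm_kac_def by measurable
  show "continuous_on UNIV (harm_poly n m AB)" for AB
    unfolding harm_poly_def by (intro continuous_intros)
qed

text \<open>The Kac-Rice density depends on the modulus only; radial integration supplies a factor
  pi that cancels the one in its denominator.\<close>

lemma expected_zeros_eq:
  "expected_zeros n n UNIV = (\<integral>\<^sup>+t. ennreal (sqrt (kac_moment 2 n t *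
     (kac_moment 2 n t - (kac_moment 1 n t)\<^sup>2 / kac_moment 0 n t)) / (2 * kac_moment 0 n t * t)) * indicator {0..} t \<partial>lborel)"
proof -
  interpret product_sigma_finite "\<lambda>_::nat. cgauss" ..
  let ?M = "Pi\<^sub>M {..n} (\<lambda>_. cgauss)" and ?M' = "Pi\<^sub>M {1..n} (\<lambda>_. cgauss)"
  let ?N = "\<lambda>AB. num_zeros (harm_poly n n AB) UNIV"
  interpret M: sigma_finite_measure ?M by (rule sigma_finite) simp
  interpret M': sigma_finite_measure ?M' by (rule sigma_finite) simp
  interpret MM: pair_sigma_finite ?M ?M ..
  interpret LM: pair_sigma_finite "lborel :: complex measure" ?M ..
  interpret LM': pair_sigma_finite "lborel :: complex measure" ?M' ..
  define K where "K B A z = ennreal (\<bar>(norm (\<Sum>k=1..n. of_nat k * A k * z ^ (k - 1)))\<^sup>2 - (norm (\<Sum>k\<le>n. of_nat k * B k * z ^ (k - 1)))\<^sup>2\<bar> *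
      gauss_density ((\<Sum>k=1..n. A k * z ^ k) + cnj (\<Sum>k\<le>n. B k * z ^ k)))" for A B z
  have N[measurable]: "?N \<in> borel_measurable (?M \<Otimes>\<^sub>M ?M)"
    using num_zeros_harm_poly_measurable[of n n] by (simp add: harm_kac_def)
  have "expected_zeros n n UNIV = (\<integral>\<^sup>+B. \<integral>\<^sup>+A. ?N (A, B) \<partial>?M \<partial>?M)"
    unfolding expected_zeros_def harm_kac_def by (rule MM.nn_integral_snd[OF N, symmetric])
  also have "\<dots> = (\<integral>\<^sup>+B. \<integral>\<^sup>+A. \<integral>\<^sup>+z. K B A z \<partial>lborel \<partial>?M' \<partial>?M)"
  proof (rule nn_integral_cong)
    fix B assume B: "B \<in> space ?M"
    have ins: "{..n} = insert 0 {1..n}" by auto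
    have "(\<lambda>A. ?N (A, B)) \<in> borel_measurable ?M"
      using B by measurable
    then have "(\<integral>\<^sup>+A. ?N (A, B) \<partial>?M) = (\<integral>\<^sup>+A. \<integral>\<^sup>+a. ?N (A(0 := a), B) \<partial>cgauss \<partial>?M')"
      unfolding ins by (intro product_nn_integral_insert) auto
    then show "(\<integral>\<^sup>+A. ?N (A, B) \<partial>?M) = (\<integral>\<^sup>+A. \<integral>\<^sup>+z. K B A z \<partial>lborel \<partial>?M')"
      by (simp add: nn_integral_num_zeros_constant_coeff K_def)
  qed
  also have "\<dots> = (\<integral>\<^sup>+B. \<integral>\<^sup>+z. \<integral>\<^sup>+A. K B A z \<partial>?M' \<partial>lborel \<partial>?M)"
  proof (rule nn_integral_cong)
    fix B assume "B \<in> space ?M"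
    show "(\<integral>\<^sup>+A. \<integral>\<^sup>+z. K B A z \<partial>lborel \<partial>?M') = (\<integral>\<^sup>+z. \<integral>\<^sup>+A. K B A z \<partial>?M' \<partial>lborel)"
      by (rule LM'.Fubini') (unfold K_def, measurable)
  qed
  also have "\<dots> = (\<integral>\<^sup>+z. \<integral>\<^sup>+B. \<integral>\<^sup>+A. K B A z \<partial>?M' \<partial>?M \<partial>lborel)"
    by (rule LM.Fubini') (unfold K_def, measurable)
  also have "\<dots> = (\<integral>\<^sup>+z. (\<lambda>t. ennreal (sqrt (kac_moment 2 n t * (kac_moment 2 n t - (kac_moment 1 n t)\<^sup>2 / kac_moment 0 n t)) /
      (2 * pi * kac_moment 0 n t * t))) ((norm (z::complex))\<^sup>2) \<partial>lborel)"
  proof (rule nn_integral_cong_AE)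
    \<comment> \<open>The origin has no phase and is discarded as a null set.\<close>
    have "AE z::complex in lborel. z \<noteq> 0" by (rule AE_lborel_singleton)
    then show "AE z in lborel. (\<integral>\<^sup>+B. \<integral>\<^sup>+A. K B A z \<partial>?M' \<partial>?M) =
        (\<lambda>t. ennreal (sqrt (kac_moment 2 n t * (kac_moment 2 n t - (kac_moment 1 n t)\<^sup>2 / kac_moment 0 n t)) /
      (2 * pi * kac_moment 0 n t * t))) ((norm z)\<^sup>2)"
      by eventually_elim (unfold K_def, rule kac_rice_density)
  qed
  also have "\<dots> = (\<integral>\<^sup>+t. ennreal pi * ennreal (sqrt (kac_moment 2 n t * (kac_moment 2 n t - (kac_moment 1 n t)\<^sup>2 / kac_moment 0 n t)) /
      (2 * pi * kac_moment 0 n t * t)) * indicator {0..} t \<partial>lborel)"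
    by (rule nn_integral_lborel_complex_radial) (unfold kac_moment_def, measurable)
  also have "\<dots> = (\<integral>\<^sup>+t. ennreal (sqrt (kac_moment 2 n t *
     (kac_moment 2 n t - (kac_moment 1 n t)\<^sup>2 / kac_moment 0 n t)) / (2 * kac_moment 0 n t * t)) * indicator {0..} t \<partial>lborel)"
    by (simp add: ennreal_mult'[symmetric] mult.assoc)
  finally show ?thesis .
qed

section \<open>Asymptotics\<close>

definition kac_intensity :: "nat \<Rightarrow> real \<Rightarrow> real" where
  "kac_intensity n t = sqrt (kac_moment 2 n t *
     (kac_moment 2 n t - (kac_moment 1 n t)\<^sup>2 / kac_moment 0 n t)) / (2 * kac_moment 0 n t * t)"

text \<open>Summation by parts in division-free form, which avoids closed forms singular at
  \<open>t = 1\<close>.\<close>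

lemma kac_moment_recurrences:
  shows "(1 - t) * kac_moment 0 n t = 1 - t ^ Suc n"
    and "(1 - t) * kac_moment 1 n t = t * kac_moment 0 n t - real (Suc n) * t ^ Suc n"
    and "(1 - t) * kac_moment 2 n t = t * (2 * kac_moment 1 n t + kac_moment 0 n t) - (real (Suc n))\<^sup>2 * t ^ Suc n"
proof -
  have step: "kac_moment j (Suc n) t = kac_moment j n t + real (Suc n) ^ j * t ^ Suc n" for j n
    by (simp add: kac_moment_def)
  have 0: "kac_moment 0 0 t = 1" "kac_moment 1 0 t = 0" "kac_moment 2 0 t = 0"
    by (simp_all add: kac_moment_def)
  show "(1 - t) * kac_moment 0 n t = 1 - t ^ Suc n"
  proof (induction n)
    case (Suc n)
    then show ?case unfolding step distrib_left by (simp add: algebra_simps)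
  qed (simp add: 0)
  show "(1 - t) * kac_moment 1 n t = t * kac_moment 0 n t - real (Suc n) * t ^ Suc n"
  proof (induction n)
    case (Suc n)
    then show ?case unfolding step distrib_left by (simp add: algebra_simps)
  qed (simp only: 0, simp)
  show "(1 - t) * kac_moment 2 n t = t * (2 * kac_moment 1 n t + kac_moment 0 n t) - (real (Suc n))\<^sup>2 * t ^ Suc n"
  proof (induction n)
    case (Suc n)
    then show ?case unfolding step distrib_left by (simp add: algebra_simps power2_eq_square)
  qed (simp only: 0, simp)
qed

text \<open>For \<open>t\<close> different from 1, with \<open>N = n + 1\<close> and
  \<open>q = t^N\<close>, this says that the variance is \<open>t/(1-t)^2 - N^2 q/(1-q)^2\<close>:
  that of a geometric law minus a truncation correction.\<close>

lemma kac_moment_variance: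
  "(1 - t)\<^sup>2 * (kac_moment 0 n t * kac_moment 2 n t - (kac_moment 1 n t)\<^sup>2) =
    t * (kac_moment 0 n t)\<^sup>2 - (real (Suc n))\<^sup>2 * t ^ Suc n"
proof -
  define a b c N q where "a = kac_moment 0 n t" and "b = kac_moment 1 n t" and "c = kac_moment 2 n t"
    and "N = real (Suc n)" and "q = t ^ Suc n"
  have r: "(1 - t) * a = 1 - q" "(1 - t) * b = t * a - N * q" "(1 - t) * c = t * (2 * b + a) - N\<^sup>2 * q"
    using kac_moment_recurrences[of t n] by (simp_all add: a_def b_def c_def N_def q_def)
  have "(1 - t)\<^sup>2 * (a * c - b\<^sup>2) = ((1 - t) * a) * ((1 - t) * c) - ((1 - t) * b)\<^sup>2"
    by (simp add: power2_eq_square algebra_simps)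
  also have "\<dots> = ((1 - t) * a) * (t * (2 * b + a) - N\<^sup>2 * q) - ((1 - t) * b)\<^sup>2"
    by (simp only: r(3))
  also have "\<dots> = 2 * t * a * ((1 - t) * b) + (1 - t) * t * a\<^sup>2 - N\<^sup>2 * q * ((1 - t) * a) - ((1 - t) * b)\<^sup>2"
    by (simp add: power2_eq_square algebra_simps)
  also have "\<dots> = t * a\<^sup>2 - N\<^sup>2 * q"
    unfolding r(1,2) by (simp add: power2_eq_square algebra_simps)
  finally show ?thesis by (simp add: a_def b_def c_def N_def q_def)
qed

lemma kac_moment_2_le: "0 \<le> t \<Longrightarrow> kac_moment 2 n t \<le> (real n)\<^sup>2 * kac_moment 0 n t"
  unfolding kac_moment_def sum_distrib_left
  by (intro sum_mono) (auto intro!: mult_right_mono power_mono)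

lemma kac_intensity_eq:
  fixes n :: nat
  assumes "0 < t"
  defines "m \<equiv> \<lambda>j. kac_moment j n t"
  shows "kac_intensity n t = sqrt (m 2 / m 0) * sqrt ((m 0 * m 2 - (m 1)\<^sup>2) / (m 0)\<^sup>2) / (2 * t)"
proof -
  have m0: "m 0 > 0" using kac_moment_ge_1[of t n] assms by simp
  have "m 2 * (m 2 - (m 1)\<^sup>2 / m 0) = (m 0)\<^sup>2 * ((m 2 / m 0) * ((m 0 * m 2 - (m 1)\<^sup>2) / (m 0)\<^sup>2))"
    using m0 by (simp add: field_simps power2_eq_square)
  then have "sqrt (m 2 * (m 2 - (m 1)\<^sup>2 / m 0)) = m 0 * (sqrt (m 2 / m 0) * sqrt ((m 0 * m 2 - (m 1)\<^sup>2) / (m 0)\<^sup>2))"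
    using m0 by (simp only: real_sqrt_mult real_sqrt_abs abs_of_pos)
  then show ?thesis
    unfolding kac_intensity_def using m0 by (simp add: m_def)
qed

text \<open>The three bounds come from \<open>V \<le> S\<close>, from \<open>S \<le> n^2\<close> in
  addition, and from dropping the truncation correction in \<open>V\<close>. They serve below 1,
  near 1 and above 1 respectively.\<close>

lemma kac_intensity_bounds:
  assumes t: "0 < t"
  shows "kac_intensity n t \<le> (kac_moment 2 n t / kac_moment 0 n t) / (2 * t)"
    and "kac_intensity n t \<le> (real n)\<^sup>2 / (2 * t)"
    and "t \<noteq> 1 \<Longrightarrow> kac_intensity n t \<le> real n * (sqrt t / \<bar>1 - t\<bar>) / (2 * t)"
proof -
  define m where "m = (\<lambda>j. kac_moment j n t)"
  have m0: "m 0 > 0" and m2: "m 2 \<ge> 0"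
    using kac_moment_ge_1[of t n] kac_moment_nonneg[of t 2 n] t by (auto simp: m_def)
  define S V where "S = m 2 / m 0" and "V = (m 0 * m 2 - (m 1)\<^sup>2) / (m 0)\<^sup>2"
  have eq: "kac_intensity n t = sqrt S * sqrt V / (2 * t)"
    unfolding S_def V_def m_def by (rule kac_intensity_eq[OF t])
  have S: "0 \<le> S" "S \<le> (real n)\<^sup>2"
    using m0 m2 kac_moment_2_le[of t n] t by (simp_all add: S_def m_def divide_le_eq)
  have VS: "V \<le> S"
    using m0 by (simp add: S_def V_def field_simps power2_eq_square)
  have sV: "sqrt V \<le> sqrt S" using VS by simp
  have sSV: "sqrt S * sqrt V \<le> S"
    using mult_left_mono[OF sV, of "sqrt S"] S by simp
  show "kac_intensity n t \<le> (kac_moment 2 n t / kac_moment 0 n t) / (2 * t)"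
    using divide_right_mono[OF sSV, of "2 * t"] t unfolding eq S_def m_def by simp
  show "kac_intensity n t \<le> (real n)\<^sup>2 / (2 * t)"
    unfolding eq using sSV S t by (intro divide_right_mono) auto
  assume t1: "t \<noteq> 1"
  have "(1 - t)\<^sup>2 * V = (t * (m 0)\<^sup>2 - (real (Suc n))\<^sup>2 * t ^ Suc n) / (m 0)\<^sup>2"
    using kac_moment_variance[of t n] by (simp add: V_def m_def)
  also have "\<dots> \<le> (t * (m 0)\<^sup>2) / (m 0)\<^sup>2"
    using t by (intro divide_right_mono) auto
  also have "\<dots> = t" using m0 by simp
  finally have "V \<le> t / (1 - t)\<^sup>2"
    using t1 by (simp add: field_simps)
  then have "sqrt V \<le> sqrt t / \<bar>1 - t\<bar>"
    using real_sqrt_le_mono by (fastforce simp: real_sqrt_divide)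
  moreover have "sqrt S \<le> real n"
    using S by (simp add: real_le_lsqrt)
  ultimately have "sqrt S * sqrt V \<le> real n * (sqrt t / \<bar>1 - t\<bar>)"
    using S t by (intro order_trans[OF mult_left_mono mult_right_mono]) auto
  then show "kac_intensity n t \<le> real n * (sqrt t / \<bar>1 - t\<bar>) / (2 * t)"
    unfolding eq using t by (intro divide_right_mono) auto
qed

text \<open>Dropping the negative boundary terms of the recurrences bounds \<open>S\<close> by the
  second moment \<open>t(1+t)/(1-t)^2\<close> of the full geometric law, uniformly in
  \<open>n\<close>.\<close>

lemma kac_intensity_le_inside:
  assumes t: "0 < t" "t < 1"
  shows "kac_intensity n t \<le> 1 / (1 - t)\<^sup>2"
proof -
  define a b c where "a = kac_moment 0 n t" and "b = kac_moment 1 n t" and "c = kac_moment 2 n t"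
  have a: "a \<ge> 1" using kac_moment_ge_1[of t n] t by (simp add: a_def)
  have r: "(1 - t) * b \<le> t * a" "(1 - t) * c \<le> t * (2 * b + a)"
    using kac_moment_recurrences(2,3)[of t n] t by (simp_all add: a_def b_def c_def)
  have "(1 - t)\<^sup>2 * c = (1 - t) * ((1 - t) * c)" by (simp add: power2_eq_square)
  also have "\<dots> \<le> (1 - t) * (t * (2 * b + a))"
    using r(2) t by (intro mult_left_mono) auto
  also have "\<dots> = 2 * t * ((1 - t) * b) + (1 - t) * t * a" by (simp add: algebra_simps)
  also have "\<dots> \<le> 2 * t * (t * a) + (1 - t) * t * a"
    using r(1) t by (intro add_right_mono mult_left_mono) auto
  also have "\<dots> = t * a * (1 + t)" by (simp add: algebra_simps)
  also have "\<dots> \<le> t * a * 2"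
    using t a by (intro mult_left_mono) auto
  finally have "(1 - t)\<^sup>2 * c \<le> 2 * t * a" by simp
  then have "(c / a) / (2 * t) \<le> 1 / (1 - t)\<^sup>2"
    using t a by (simp add: field_simps)
  then show ?thesis
    using kac_intensity_bounds(1)[OF t(1), of n] by (simp add: a_def c_def)
qed

text \<open>Above 1 the weights concentrate near \<open>k = n\<close>, so the mean, and with it
  \<open>sqrt S\<close>, is nearly \<open>n\<close>, while the truncation correction is small once
  \<open>x = N (t - 1)\<close> is large. The last factor comes from
  \<open>1/(t(t-1)) = 1/(t-1) - 1/t\<close>. The constant is \<open>864 = 4 * 6^3\<close>: 4 from
  \<open>q - 1 \<ge> q/2\<close>, and \<open>6^3\<close> from the cubic bound on
  \<open>q\<close>.\<close>

lemma kac_intensity_ge_outside: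
  assumes L: "864 \<le> L" and t: "1 + L / real (Suc n) \<le> t" "t \<le> 2"
  shows "(real n - real (Suc n) / L) * (1 - 864 / L) / 2 * (1 / (t - 1) - 1) \<le> kac_intensity n t"
proof -
  define N where "N = real (Suc n)"
  define x where "x = N * (t - 1)"
  define q where "q = t ^ Suc n"
  have N: "N \<ge> 1" by (simp add: N_def)
  have LN: "L / N > 0" using L N by simp
  have t1: "t > 1" using t LN by (simp add: N_def)
  have "L / N \<le> t - 1" using t by (simp add: N_def)
  then have x: "x \<ge> L" using N by (simp add: x_def pos_divide_le_eq mult.commute)
  define m where "m = (\<lambda>j. kac_moment j n t)"
  have m0: "m 0 \<ge> 1" using kac_moment_ge_1[of t n] t1 by (simp add: m_def)
  define S V where "S = m 2 / m 0" and "V = (m 0 * m 2 - (m 1)\<^sup>2) / (m 0)\<^sup>2"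
  have eq: "kac_intensity n t = sqrt S * sqrt V / (2 * t)"
    unfolding S_def V_def m_def by (rule kac_intensity_eq) (use t1 in simp)
  have mq: "m 0 * (t - 1) = q - 1"
    using kac_moment_recurrences(1)[of t n] by (simp add: m_def q_def algebra_simps)
  \<comment> \<open>For \<open>t \<le> 2\<close> one has
    \<open>ln t \<ge> 1 - 1/t \<ge> (t-1)/2\<close>, so \<open>q \<ge> exp (x/2)\<close>. A cubic
    bound is what is needed to beat the factor \<open>x^2\<close> in the correction.\<close>
  have q: "q \<ge> (x / 6) ^ 3"
  proof -
    have "(t - 1) / 2 \<le> ln t"
    proof -
      have "ln (1 / t) \<le> 1 / t - 1" using t1 by (intro ln_le_minus_one) auto
      then have "1 - 1 / t \<le> ln t" using t1 by (simp add: ln_div)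
      moreover have "(t - 1) / 2 \<le> 1 - 1 / t"
        using t1 t(2) mult_right_mono[of t 2 "t - 1"] by (simp add: field_simps)
      ultimately show ?thesis by linarith
    qed
    then have "x / 2 \<le> N * ln t"
      using N mult_left_mono[of "(t - 1) / 2" "ln t" N] by (simp add: x_def)
    have "(x / 6) ^ 3 \<le> (1 + x / 6) ^ 3" using x L by (intro power_mono) auto
    also have "\<dots> \<le> exp (x / 6) ^ 3" using x L by (intro power_mono exp_ge_add_one_self) auto
    also have "\<dots> = exp (x / 2)" by (simp add: exp_of_nat_mult[symmetric])
    also have "\<dots> \<le> exp (N * ln t)" using \<open>x / 2 \<le> N * ln t\<close> by simp
    also have "\<dots> = q" using t1 by (simp add: N_def q_def exp_of_nat_mult del: power_Suc of_nat_Suc)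
    finally show ?thesis .
  qed
  have q2: "q \<ge> 2"
  proof -
    have "(2::real) \<le> 144 ^ 3" by simp
    also have "\<dots> \<le> (x / 6) ^ 3" using x L by (intro power_mono) auto
    finally show ?thesis using q by linarith
  qed
  \<comment> \<open>The root of the second moment dominates the mean, and the first recurrence with
    \<open>q \<ge> q - 1\<close> bounds the mean below by \<open>n - 1/(t-1)\<close>.\<close>
  have MS: "(real n - N / L) \<le> sqrt S"
  proof -
    have "m 1 * (t - 1) = N * q - t * m 0"
      using kac_moment_recurrences(2)[of t n] by (simp add: m_def q_def N_def algebra_simps)
    moreover have "N * q \<ge> N * (m 0 * (t - 1))" using mq N by (intro mult_left_mono) auto
    ultimately have "m 1 * (t - 1) \<ge> (N * (t - 1) - t) * m 0" by (simp add: algebra_simps)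
    then have "m 1 / m 0 \<ge> (N * (t - 1) - t) / (t - 1)"
      using m0 t1 by (simp add: field_simps)
    also have "(N * (t - 1) - t) / (t - 1) = real n - 1 / (t - 1)"
      using t1 by (simp add: N_def field_simps)
    finally have M: "real n - 1 / (t - 1) \<le> m 1 / m 0" by simp
    have "1 / (t - 1) \<le> N / L"
      using x L t1 N by (simp add: x_def field_simps)
    with M have "real n - N / L \<le> m 1 / m 0" by linarith
    also have "m 1 / m 0 \<le> sqrt S"
    proof (rule real_le_rsqrt)
      have "(m 1)\<^sup>2 \<le> m 0 * m 2"
        using kac_moment_Cauchy_Schwarz[of t n] kac_moment_nonneg[of t 2 n] t1 by (simp add: m_def algebra_simps)
      then show "(m 1 / m 0)\<^sup>2 \<le> S"
        using m0 by (simp add: S_def power_divide field_simps power2_eq_square)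
    qed
    finally show ?thesis .
  qed
  have V: "(t - 1)\<^sup>2 * V \<ge> 1 - 864 / L"
  proof -
    have "(t - 1)\<^sup>2 * V = (t * (m 0)\<^sup>2 - N\<^sup>2 * q) / (m 0)\<^sup>2"
      using kac_moment_variance[of t n] by (simp add: V_def m_def N_def q_def power2_commute[of t 1])
    also have "\<dots> = t - N\<^sup>2 * q / (m 0)\<^sup>2"
      using m0 by (simp add: diff_divide_distrib)
    also have "N\<^sup>2 * q / (m 0)\<^sup>2 = x\<^sup>2 * q / (q - 1)\<^sup>2"
      using m0 t1 by (simp add: mq[symmetric] x_def power_mult_distrib)
    finally have eqV: "(t - 1)\<^sup>2 * V = t - x\<^sup>2 * q / (q - 1)\<^sup>2" .
    have "x\<^sup>2 * q / (q - 1)\<^sup>2 \<le> x\<^sup>2 * q / (q / 2)\<^sup>2"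
      using q2 by (intro divide_left_mono power_mono mult_pos_pos) auto
    also have "\<dots> = 4 * x\<^sup>2 / q"
      using q2 by (simp add: power2_eq_square)
    also have "\<dots> \<le> 4 * x\<^sup>2 / (x / 6) ^ 3"
      using q q2 x L by (intro divide_left_mono mult_pos_pos) auto
    also have "\<dots> = 864 / x"
      using x L by (simp add: power2_eq_square power3_eq_cube)
    also have "\<dots> \<le> 864 / L"
      using x L by (intro divide_left_mono) auto
    finally show ?thesis using eqV t1 by linarith
  qed
  have L1: "0 \<le> 1 - 864 / L" "1 - 864 / L \<le> 1" using L by simp_all
  \<comment> \<open>A number in \<open>[0, 1]\<close> is at least its own square, so
    \<open>1 - 864/L\<close> may stand for its square root.\<close>
  have sV: "(1 - 864 / L) / (t - 1) \<le> sqrt V"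
  proof (rule real_le_rsqrt)
    have "(1 - 864 / L)\<^sup>2 \<le> 1 - 864 / L"
      using L1 mult_right_mono[of "1 - 864 / L" 1 "1 - 864 / L"] by (simp add: power2_eq_square)
    also have "\<dots> \<le> (t - 1)\<^sup>2 * V" by (rule V)
    finally show "((1 - 864 / L) / (t - 1))\<^sup>2 \<le> V"
      using t1 by (simp add: power_divide divide_le_eq mult.commute)
  qed
  have n: "0 \<le> real n - N / L"
  proof -
    have "N \<le> L * real n"
    proof -
      have "L / N \<le> 1" using t unfolding N_def by linarith
      then have "N \<ge> 864" using L N by (simp add: divide_le_eq)
      then have "real n \<ge> 1" by (simp add: N_def)
      moreover have "2 * real n \<le> L * real n" using L by (intro mult_right_mono) auto
      ultimately show ?thesis unfolding N_def of_nat_Suc by linarith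
    qed
    then show ?thesis using L by (simp add: divide_le_eq mult.commute)
  qed
  have "(real n - N / L) * (1 - 864 / L) / 2 * (1 / (t - 1) - 1) =
      (real n - N / L) * ((1 - 864 / L) * (1 / (t - 1) - 1)) / 2" by simp
  also have "\<dots> \<le> (real n - N / L) * ((1 - 864 / L) * (1 / (t - 1) / t)) / 2"
  proof -
    have "1 / (t - 1) - 1 \<le> 1 / (t - 1) / t"
    proof -
      have "1 / (t - 1) - 1 / (t - 1) / t = (1 - 1 / t) / (t - 1)"
        by (simp add: diff_divide_distrib mult.commute)
      also have "1 - 1 / t = (t - 1) / t"
        using t1 by (simp add: diff_divide_distrib)
      also have "(t - 1) / t / (t - 1) = 1 / t"
        using t1 by simp
      also have "\<dots> \<le> 1" using t1 by simp
      finally show ?thesis by simp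
    qed
    then show ?thesis
      using n L1 by (intro divide_right_mono mult_left_mono) auto
  qed
  also have "\<dots> = (real n - N / L) * ((1 - 864 / L) / (t - 1)) / (2 * t)"
    by simp
  also have "\<dots> \<le> sqrt S * sqrt V / (2 * t)"
    using MS sV n L1 t1 by (intro divide_right_mono mult_mono') auto
  finally show ?thesis by (simp add: eq N_def)
qed

section \<open>Integrating the intensity bounds\<close>

text \<open>The cut at distance \<open>1/n\<close> from 1 balances \<open>1/\<delta>\<close> from
  the left against \<open>2 n^2 \<delta>\<close> from the middle. The logarithm is the integral of
  \<open>1/(t-1)\<close> over \<open>[1 + 1/n, 2]\<close>, and \<open>5 = 1 + 2 + 2\<close> collects
  the left, middle and far ranges.\<close>

lemma nn_integral_kac_intensity_le:
  assumes n: "2 \<le> n"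
  shows "(\<integral>\<^sup>+t. ennreal (kac_intensity n t) * indicator {0..} t \<partial>lborel) \<le> ennreal (1/2 * real n * ln (real n) + 5 * real n)"
proof -
  define \<delta> where "\<delta> = 1 / real n"
  have \<delta>: "0 < \<delta>" "\<delta> \<le> 1 / 2" "real n * \<delta> = 1" using n by (simp_all add: \<delta>_def field_simps)
  define g1 where "g1 t = ennreal (1 / (1 - t)\<^sup>2) * indicator {0..1 - \<delta>} t" for t :: real
  define g2 where "g2 t = ennreal ((real n)\<^sup>2) * indicator {1 - \<delta>..1 + \<delta>} t" for t :: real
  define g3 where "g3 t = ennreal (real n / 2 / (t - 1)) * indicator {1 + \<delta>..2} t" for t :: real
  define g4 where "g4 t = ennreal (real n / (t * sqrt t)) * indicator {2..} t" for t :: real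
  have [measurable]: "g1 \<in> borel_measurable borel" "g2 \<in> borel_measurable borel"
      "g3 \<in> borel_measurable borel" "g4 \<in> borel_measurable borel"
    unfolding g1_def[abs_def] g2_def[abs_def] g3_def[abs_def] g4_def[abs_def] by measurable
  have le: "ennreal (kac_intensity n t) * indicator {0..} t \<le> g1 t + (g2 t + (g3 t + g4 t))" for t
  proof -
    consider "t \<le> 0" | "0 < t" "t \<le> 1 - \<delta>" | "1 - \<delta> \<le> t" "t \<le> 1 + \<delta>" | "1 + \<delta> \<le> t" "t \<le> 2" | "2 \<le> t"
      by linarith
    then show ?thesis
    proof cases
      case 1
      \<comment> \<open>Of these points only \<open>t = 0\<close> survives the indicator, and there
        division by 0 yields 0.\<close>
      then have "ennreal (kac_intensity n t) * indicator {0..} t = 0"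
        by (cases "t = 0") (auto simp: kac_intensity_def)
      then show ?thesis by (metis zero_le)
    next
      case 2
      have "ennreal (kac_intensity n t) \<le> g1 t"
        using 2 kac_intensity_le_inside[of t n] \<delta> by (auto simp: g1_def intro!: ennreal_leI)
      then show ?thesis using 2 by (simp add: add_increasing2)
    next
      case 3
      have "kac_intensity n t \<le> (real n)\<^sup>2 / (2 * t)"
        using 3 \<delta> by (intro kac_intensity_bounds) auto
      \<comment> \<open>Here \<open>2 t \<ge> 1\<close>, because
        \<open>\<delta> \<le> 1/2\<close>.\<close>
      also have "\<dots> \<le> (real n)\<^sup>2 / 1"
        using 3 \<delta> by (intro divide_left_mono) auto
      finally have "ennreal (kac_intensity n t) \<le> g2 t"
        using 3 by (auto simp: g2_def intro!: ennreal_leI)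
      then show ?thesis using 3 \<delta> by (simp add: add_increasing add_increasing2)
    next
      case 4
      have "kac_intensity n t \<le> real n * (sqrt t / \<bar>1 - t\<bar>) / (2 * t)"
        using 4 \<delta> by (intro kac_intensity_bounds) auto
      also have "\<dots> = real n / 2 / (t - 1) * (sqrt t / t)"
        using 4 \<delta> by simp
      also have "\<dots> \<le> real n / 2 / (t - 1) * 1"
      proof (rule mult_left_mono)
        have "sqrt t \<le> sqrt (t\<^sup>2)"
          using 4 \<delta> by (intro real_sqrt_le_mono self_le_power) auto
        then show "sqrt t / t \<le> 1"
          using 4 \<delta> by simp
      qed (use 4 \<delta> in auto)
      finally have "ennreal (kac_intensity n t) \<le> g3 t"
        using 4 by (auto simp: g3_def intro!: ennreal_leI)
      then show ?thesis using 4 \<delta> by (simp add: add_increasing add_increasing2)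
    next
      case 5
      have "kac_intensity n t \<le> real n * (sqrt t / \<bar>1 - t\<bar>) / (2 * t)"
        using 5 by (intro kac_intensity_bounds) auto
      also have "\<dots> \<le> real n * (sqrt t / (t / 2)) / (2 * t)"
        using 5 by (intro divide_right_mono mult_left_mono divide_left_mono) auto
      also have "\<dots> = real n * (sqrt t / (t * t))"
        using 5 by simp
      also have "sqrt t / (t * t) = 1 / (t * sqrt t)"
        using 5 by (simp add: field_simps)
      finally have "ennreal (kac_intensity n t) \<le> g4 t"
        using 5 by (auto simp: g4_def intro!: ennreal_leI)
      then show ?thesis using 5 by (simp add: add_increasing add_increasing2)
    qed
  qed
  have i1: "integral\<^sup>N lborel g1 = ennreal (1 / (1 - (1 - \<delta>)) - 1 / (1 - 0))"
    unfolding g1_def[abs_def]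
  proof (rule nn_integral_FTC_Icc[where F = "\<lambda>t. 1 / (1 - t)"])
    show "((\<lambda>t. 1 / (1 - t)) has_real_derivative 1 / (1 - t)\<^sup>2) (at t)" if "t \<in> {0..1 - \<delta>}" for t
      using that \<delta> by (auto intro!: derivative_eq_intros simp: power2_eq_square)
  qed (use \<delta> in auto)
  have i2: "integral\<^sup>N lborel g2 = ennreal ((real n)\<^sup>2 * (2 * \<delta>))"
    unfolding g2_def[abs_def] using \<delta> by (simp add: nn_integral_cmult_indicator ennreal_mult)
  have i3: "integral\<^sup>N lborel g3 = ennreal (real n / 2 * ln (2 - 1) - real n / 2 * ln (1 + \<delta> - 1))"
    unfolding g3_def[abs_def]
  proof (rule nn_integral_FTC_Icc[where F = "\<lambda>t. real n / 2 * ln (t - 1)"])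
    show "((\<lambda>t. real n / 2 * ln (t - 1)) has_real_derivative real n / 2 / (t - 1)) (at t)" if "t \<in> {1 + \<delta>..2}" for t
      using that \<delta> by (auto intro!: derivative_eq_intros simp: field_simps)
  qed (use \<delta> in auto)
  have i4: "integral\<^sup>N lborel g4 = ennreal (0 - (- 2 * real n / sqrt 2))"
    unfolding g4_def[abs_def]
  proof (rule nn_integral_FTC_atLeast[where F = "\<lambda>t. - 2 * real n / sqrt t"])
    show "((\<lambda>t. - 2 * real n / sqrt t) has_real_derivative real n / (t * sqrt t)) (at t)" if "2 \<le> t" for t
      using that by (auto intro!: derivative_eq_intros simp: field_simps power2_eq_square)
    show "((\<lambda>t. - 2 * real n / sqrt t) \<longlongrightarrow> 0) at_top"
      by real_asymp
  qed auto
  have "(\<integral>\<^sup>+t. ennreal (kac_intensity n t) * indicator {0..} t \<partial>lborel) \<le> (\<integral>\<^sup>+t. g1 t + (g2 t + (g3 t + g4 t)) \<partial>lborel)"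
    by (intro nn_integral_mono le)
  also have "\<dots> = integral\<^sup>N lborel g1 + (integral\<^sup>N lborel g2 + (integral\<^sup>N lborel g3 + integral\<^sup>N lborel g4))"
    by (simp add: nn_integral_add)
  also have "integral\<^sup>N lborel g1 \<le> ennreal (real n)"
    unfolding i1 using n by (intro ennreal_leI) (simp add: \<delta>_def)
  also have "integral\<^sup>N lborel g2 = ennreal (2 * real n)"
    unfolding i2 using \<delta> by (simp add: power2_eq_square)
  also have "integral\<^sup>N lborel g3 = ennreal (1/2 * real n * ln (real n))"
    unfolding i3 using n by (simp add: \<delta>_def ln_div)
  also have "integral\<^sup>N lborel g4 \<le> ennreal (2 * real n)"
    unfolding i4 using mult_left_mono[of 1 "sqrt 2" "real n"]
    by (intro ennreal_leI) (simp add: divide_le_eq)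
  finally have "(\<integral>\<^sup>+t. ennreal (kac_intensity n t) * indicator {0..} t \<partial>lborel) \<le>
      ennreal (real n) + (ennreal (2 * real n) + (ennreal (1/2 * real n * ln (real n)) + ennreal (2 * real n)))"
    by (simp add: add_mono)
  also have "\<dots> = ennreal (1/2 * real n * ln (real n) + 5 * real n)"
    using n by (simp add: ennreal_plus[symmetric] del: ennreal_plus)
  finally show ?thesis .
qed

text \<open>Only the range from \<open>1 + L/(n+1)\<close> to 2 is kept. \<open>L\<close> stays free
  because the relative error shrinks as \<open>L\<close> grows while the logarithm loses
  \<open>ln L\<close>.\<close>

lemma nn_integral_kac_intensity_ge:
  assumes L: "864 \<le> L" "L \<le> real (Suc n)"
  shows "ennreal ((real n - real (Suc n) / L) * (1 - 864 / L) / 2 * (ln (real (Suc n) / L) - 1)) \<le>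
    (\<integral>\<^sup>+t. ennreal (kac_intensity n t) * indicator {0..} t \<partial>lborel)"
proof -
  define c where "c = (real n - real (Suc n) / L) * (1 - 864 / L) / 2"
  define \<delta> where "\<delta> = L / real (Suc n)"
  have \<delta>: "0 < \<delta>" "\<delta> \<le> 1" using L by (simp_all add: \<delta>_def)
  have c: "c \<ge> 0"
  proof -
    have "864 * real n \<le> L * real n" using L by (intro mult_right_mono) auto
    moreover have "863 \<le> real n" using L by simp
    ultimately have "real (Suc n) \<le> L * real n" unfolding of_nat_Suc by linarith
    then have "real (Suc n) / L \<le> real n" using L by (simp add: divide_le_eq mult.commute)
    moreover have "864 / L \<le> 1" using L by simp
    ultimately show ?thesis by (simp add: c_def)
  qed
  have "ennreal (c * (ln (real (Suc n) / L) - 1)) \<le> ennreal (c * (ln (2 - 1) - 2) - c * (ln (1 + \<delta> - 1) - (1 + \<delta>)))"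
  proof (rule ennreal_leI)
    have "c * (ln (2 - 1) - 2) - c * (ln (1 + \<delta> - 1) - (1 + \<delta>)) = c * (- ln \<delta> - 1 + \<delta>)"
      by (simp add: algebra_simps)
    also have "- ln \<delta> = ln (real (Suc n) / L)"
      using L by (simp add: \<delta>_def ln_div)
    finally show "c * (ln (real (Suc n) / L) - 1) \<le> c * (ln (2 - 1) - 2) - c * (ln (1 + \<delta> - 1) - (1 + \<delta>))"
      using c \<delta> by (simp add: mult_left_mono)
  qed
  also have "\<dots> = (\<integral>\<^sup>+t. ennreal (c * (1 / (t - 1) - 1)) * indicator {1 + \<delta>..2} t \<partial>lborel)"
  proof (rule nn_integral_FTC_Icc[where F = "\<lambda>t. c * (ln (t - 1) - t)", symmetric])
    show "((\<lambda>t. c * (ln (t - 1) - t)) has_real_derivative c * (1 / (t - 1) - 1)) (at t)" if "t \<in> {1 + \<delta>..2}" for t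
      using that \<delta> by (auto intro!: derivative_eq_intros)
    show "0 \<le> c * (1 / (t - 1) - 1)" if "t \<in> {1 + \<delta>..2}" for t
      using that \<delta> c by (intro mult_nonneg_nonneg) auto
  qed (use \<delta> in auto)
  also have "\<dots> \<le> (\<integral>\<^sup>+t. ennreal (kac_intensity n t) * indicator {0..} t \<partial>lborel)"
  proof (rule nn_integral_mono)
    fix t
    show "ennreal (c * (1 / (t - 1) - 1)) * indicator {1 + \<delta>..2} t \<le> ennreal (kac_intensity n t) * indicator {0..} t"
      using kac_intensity_ge_outside[OF L(1), of n t] \<delta>
      by (auto simp: c_def \<delta>_def split: split_indicator intro!: ennreal_leI)
  qed
  finally show ?thesis by (simp add: c_def)
qed

theorem theorem1p3:
  shows "(\<lambda>n::nat. enn2real (expected_zeros n n UNIV)) \<sim>[at_top] (\<lambda>n. 1/2 * real n * ln (real n))"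
proof (rule asymp_equivI')
  define E where "E n = expected_zeros n n UNIV" for n
  have E: "E n = (\<integral>\<^sup>+t. ennreal (kac_intensity n t) * indicator {0..} t \<partial>lborel)" for n
    by (simp only: E_def expected_zeros_eq kac_intensity_def)
  define U where "U n = 1/2 * real n * ln (real n) + 5 * real n" for n
  \<comment> \<open>The cutoff parameter is \<open>ln (n + 1)\<close>: it tends to infinity, so the
    error factors tend to 1, yet its own logarithm is negligible against
    \<open>ln n\<close>.\<close>
  define L where "L n = (real n - real (Suc n) / ln (real (Suc n))) * (1 - 864 / ln (real (Suc n))) / 2 *
      (ln (real (Suc n) / ln (real (Suc n))) - 1)" for n
  have U: "E n \<le> ennreal (U n)" if "2 \<le> n" for n
    unfolding E U_def by (rule nn_integral_kac_intensity_le[OF that])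
  have upper: "eventually (\<lambda>n. enn2real (E n) \<le> U n) at_top"
    using eventually_ge_at_top[of 2]
  proof eventually_elim
    case (elim n)
    then have "0 \<le> U n" by (simp add: U_def)
    with U[OF elim] show ?case by (simp add: enn2real_leI)
  qed
  have "eventually (\<lambda>n. 864 \<le> ln (real (Suc n))) at_top"
    by real_asymp
  then have lower: "eventually (\<lambda>n. L n \<le> enn2real (E n)) at_top"
    using eventually_ge_at_top[of 2]
  proof eventually_elim
    case (elim n)
    have "ln (real (Suc n)) \<le> real (Suc n)"
      using ln_le_minus_one[of "real (Suc n)"] by simp
    then have "ennreal (L n) \<le> E n"
      unfolding E L_def by (intro nn_integral_kac_intensity_ge elim)
    \<comment> \<open>Finiteness matters because \<open>enn2real\<close> sends infinity to
      0.\<close>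
    moreover have "E n < top"
      using U[OF elim(2)] by (simp add: le_less_trans)
    ultimately have "enn2real (ennreal (L n)) \<le> enn2real (E n)"
      by (intro enn2real_mono)
    \<comment> \<open>For negative \<open>L n\<close> the \<open>ennreal\<close> comparison says
      nothing, but then the claim follows from nonnegativity.\<close>
    then show ?case
      by (cases "0 \<le> L n") (auto intro: order_trans[OF _ enn2real_nonneg])
  qed
  have pos: "eventually (\<lambda>n. 1/2 * real n * ln (real n) > 0) at_top"
    using eventually_ge_at_top[of 2] by eventually_elim simp
  show "((\<lambda>n. enn2real (expected_zeros n n UNIV) / (1/2 * real n * ln (real n))) \<longlongrightarrow> 1) at_top"
    unfolding E_def[symmetric]
  proof (rule tendsto_sandwich)
    show "eventually (\<lambda>n. L n / (1/2 * real n * ln (real n)) \<le> enn2real (E n) / (1/2 * real n * ln (real n))) at_top"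
      using lower pos by eventually_elim (rule divide_right_mono, auto)
    show "eventually (\<lambda>n. enn2real (E n) / (1/2 * real n * ln (real n)) \<le> U n / (1/2 * real n * ln (real n))) at_top"
      using upper pos by eventually_elim (rule divide_right_mono, auto)
    show "((\<lambda>n. L n / (1/2 * real n * ln (real n))) \<longlongrightarrow> 1) at_top"
      unfolding L_def by real_asymp
    show "((\<lambda>n. U n / (1/2 * real n * ln (real n))) \<longlongrightarrow> 1) at_top"
      unfolding U_def by real_asymp
  qed
qed

end
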